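(* There exists a translation invariant site percolation $X$ on $\mathbb{Z}^2$ that satisfies uniform finite energy and that produces, almost surely, an infinite open cluster and an infinite closed cluster.
   Context: A site percolation on $\mathbb{Z}^2$ is a $\{0,1\}^{\mathbb{Z}^2}$-valued random object $X$. It is translation invariant if for any $n$ and any $x_1,\ldots,x_n\in\mathbb{Z}^2$, the distribution of $(X(x_1+y),\ldots,X(x_n+y))$ does not depend on $y\in\mathbb{Z}^2$. Two vertices $x,y\in\mathbb{Z}^2$ communicate if there is a path $\{z_1,\ldots,z_n\}$ from $z_1=x$ to $z_n=y$, with consecutive vertices being $L_1$-nearest neighbors (at $L_1$-distance $1$), such that $X(z_1)=X(z_2)=\cdots=X(z_n)$. A connected component is a maximal set of vertices that all communicate with each other; it is called an open cluster if its vertices take value $1$ in $X$, and a closed cluster if its vertices take value $0$ in $X$. A site percolation $X$ on $\mathbb{Z}^2$ satisfies uniform finite energy if for some $\varepsilon>0$ it admits conditional probabilities such that for all $x\in\mathbb{Z}^2$ and all $\xi\in\{0,1\}^{\mathbb{Z}^2\setminus\{x\}}$ we have $$\varepsilon<\mathbf{P}\big(X(x)=1\,\big|\,X(\mathbb{Z}^2\setminus\{x\})=\xi\big)<1-\varepsilon .$$ *)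

theory Defs
  imports "HOL-Probability.Probability"
begin

type_synonym vertex = "int \<times> int"

text \<open>States are truth values: \<open>True\<close> is the value 1 (open), \<open>False\<close> the value 0 (closed).\<close>

type_synonym config = "vertex \<Rightarrow> bool"

definition config_space :: "vertex set \<Rightarrow> config measure" where
  "config_space V = PiM V (\<lambda>_. count_space UNIV)"

definition site_percolation :: "'w measure \<Rightarrow> ('w \<Rightarrow> config) \<Rightarrow> bool" where
  "site_percolation M X \<longleftrightarrow> prob_space M \<and> X \<in> M \<rightarrow>\<^sub>M config_space UNIV"

definition translation_invariant :: "'w measure \<Rightarrow> ('w \<Rightarrow> config) \<Rightarrow> bool" where
  "translation_invariant M X \<longleftrightarrow>
    (\<forall>(n::nat) (x :: nat \<Rightarrow> vertex) y y'.
      distr M (PiM {1..n} (\<lambda>_. count_space UNIV)) (\<lambda>\<omega>. \<lambda>i\<in>{1..n}. X \<omega> (x i + y)) =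
      distr M (PiM {1..n} (\<lambda>_. count_space UNIV)) (\<lambda>\<omega>. \<lambda>i\<in>{1..n}. X \<omega> (x i + y')))"

definition nearest_neighbors :: "vertex \<Rightarrow> vertex \<Rightarrow> bool" where
  "nearest_neighbors u v \<longleftrightarrow> \<bar>fst u - fst v\<bar> + \<bar>snd u - snd v\<bar> = 1"

definition communicate :: "config \<Rightarrow> vertex \<Rightarrow> vertex \<Rightarrow> bool" where
  "communicate c x y \<longleftrightarrow>
    (\<exists>zs. zs \<noteq> [] \<and> hd zs = x \<and> last zs = y \<and> successively nearest_neighbors zs \<and>
          (\<forall>u\<in>set zs. \<forall>v\<in>set zs. c u = c v))"

definition connected_component :: "config \<Rightarrow> vertex set \<Rightarrow> bool" where
  "connected_component c C \<longleftrightarrow>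
    (\<forall>x\<in>C. \<forall>y\<in>C. communicate c x y) \<and>
    (\<forall>D. C \<subseteq> D \<and> (\<forall>x\<in>D. \<forall>y\<in>D. communicate c x y) \<longrightarrow> D = C)"

definition open_cluster :: "config \<Rightarrow> vertex set \<Rightarrow> bool" where
  "open_cluster c C \<longleftrightarrow> connected_component c C \<and> (\<forall>x\<in>C. c x)"

definition closed_cluster :: "config \<Rightarrow> vertex set \<Rightarrow> bool" where
  "closed_cluster c C \<longleftrightarrow> connected_component c C \<and> (\<forall>x\<in>C. \<not> c x)"

text \<open>\<open>p\<close> is a version of \<open>\<xi> \<mapsto> P(X(x) = 1 | X(Z\<^sup>2 - {x}) = \<xi>)\<close>: it is measurable, and composed with
  the configuration off \<open>x\<close> it agrees almost surely with the conditional expectation of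
  the indicator of \<open>X(x) = 1\<close> given the sigma-algebra generated by that configuration.\<close>

definition cond_prob_open ::
    "'w measure \<Rightarrow> ('w \<Rightarrow> config) \<Rightarrow> vertex \<Rightarrow> (config \<Rightarrow> real) \<Rightarrow> bool" where
  "cond_prob_open M X x p \<longleftrightarrow>
    p \<in> borel_measurable (config_space (- {x})) \<and>
    (AE \<omega> in M.
      real_cond_exp M
        (vimage_algebra (space M) (\<lambda>\<omega>. restrict (X \<omega>) (- {x})) (config_space (- {x})))
        (indicator {\<omega> \<in> space M. X \<omega> x}) \<omega>
      = p (restrict (X \<omega>) (- {x})))"

definition uniform_finite_energy :: "'w measure \<Rightarrow> ('w \<Rightarrow> config) \<Rightarrow> bool" where
  "uniform_finite_energy M X \<longleftrightarrow>
    (\<exists>\<epsilon>>0. \<exists>p :: vertex \<Rightarrow> config \<Rightarrow> real.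
      (\<forall>x. cond_prob_open M X x (p x)) \<and>
      (\<forall>x. \<forall>\<xi> \<in> space (config_space (- {x})). \<epsilon> < p x \<xi> \<and> p x \<xi> < 1 - \<epsilon>))"

end

theory Submission
  imports Defs
begin

text \<open>
  The percolation is a deterministic rule applied to random stripes, with every site then flipped
  independently with probability \<open>1 / 162\<close>. The flips give uniform finite energy at once: whatever is
  known about the other sites, the flip variable of a site is independent of it
  (\<open>prob_open_and_off\<close>, \<open>cond_prob_law\<close>). The task is to find a translation invariant field
  whose infinite open and closed clusters both survive the flips.

  The stripes come in levels \<open>n = 0, 1, 2, ...\<close>, alternately horizontal and vertical. At each level they
  are periodic, open and closed ones alternate, and the whole pattern of the level is shifted by a uniform
  offset, independently for different levels; this makes the field translation invariant
  (\<open>distr_shift\<close>). Where stripes cross, the higher level wins. Width and period grow with the level, the period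
  much faster. So for large \<open>n\<close>, with probability close to 1, the stripes of level \<open>n + 1\<close> are far from the
  origin on the scale of level \<open>n\<close>, and the origin lies between an open and a closed one of them.
  Follow an open stripe of level \<open>n\<close> near the origin towards the open stripe of level \<open>n + 1\<close>: on the
  way it meets neither a closed stripe of level \<open>n + 1\<close> nor any stripe of higher level. Turn into the stripe of
  level \<open>n + 1\<close>, and repeat. This yields an infinite connected set of open sites, and by symmetry there is one of closed sites.

  To survive the flips, the stripes of level \<open>n\<close> have room for a row of squares of side \<open>3 ^ n\<close>.
  Such a square is good if, hierarchically, at most one of its nine subsquares fails to be good. It
  then contains a connected set of unflipped sites, and these sets link up for adjacent good squares
  (\<open>backbone_connected_nonempty\<close>, \<open>backbone_linked\<close>). A square fails with probability at most
  \<open>(1 / 2) ^ 2 ^ n\<close> (\<open>prob_bad_le\<close>), which beats the number of squares along the stripe. By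
  Borel and Cantelli only finitely many levels misbehave, almost surely, and
  \<open>infinite_cluster_of_stripes\<close> assembles the clusters from the remaining ones.
\<close>

section \<open>Connected sets of sites and clusters\<close>

definition step_within :: "vertex set \<Rightarrow> vertex \<Rightarrow> vertex \<Rightarrow> bool" where
  "step_within S u v \<longleftrightarrow> u \<in> S \<and> v \<in> S \<and> nearest_neighbors u v"

definition connected_sites :: "vertex set \<Rightarrow> bool" where
  "connected_sites S \<longleftrightarrow> (\<forall>x\<in>S. \<forall>y\<in>S. (step_within S)\<^sup>*\<^sup>* x y)"

lemma nearest_neighbors_sym: "nearest_neighbors u v \<longleftrightarrow> nearest_neighbors v u"
  by (auto simp: nearest_neighbors_def abs_minus_commute)

lemma step_within_mono: "S \<subseteq> T \<Longrightarrow> (step_within S)\<^sup>*\<^sup>* x y \<Longrightarrow> (step_within T)\<^sup>*\<^sup>* x y"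
  by (erule rtranclp_mono[THEN predicate2D, rotated]) (auto simp: step_within_def)

text \<open>The gluing principle behind every connectivity argument below: connected pieces, indexed by a
  connected graph whose edges are contacts between the pieces, form a connected set.\<close>

lemma connected_sites_UN:
  assumes conn: "\<And>i. i \<in> I \<Longrightarrow> connected_sites (S i)"
    and link: "\<And>i j. R i j \<Longrightarrow> i \<in> I \<and> j \<in> I \<and>
      (\<exists>x\<in>S i. \<exists>y\<in>S j. x = y \<or> nearest_neighbors x y)"
    and reach: "\<And>i j. i \<in> I \<Longrightarrow> j \<in> I \<Longrightarrow> R\<^sup>*\<^sup>* i j"
  shows "connected_sites (\<Union>i\<in>I. S i)"
proof -
  let ?T = "\<Union>i\<in>I. S i"
  have inside: "(step_within ?T)\<^sup>*\<^sup>* x y" if "i \<in> I" "x \<in> S i" "y \<in> S i" for i x y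
    using conn[OF that(1)] that
    by (auto simp: connected_sites_def intro: step_within_mono[of "S i"])
  have "\<forall>x\<in>S i. \<forall>y\<in>S j. (step_within ?T)\<^sup>*\<^sup>* x y" if "R\<^sup>*\<^sup>* i j" "i \<in> I" for i j
    using that
  proof (induction rule: rtranclp_induct)
    case base
    then show ?case using inside by blast
  next
    case (step j k)
    show ?case
    proof (intro ballI)
      fix x y assume xy: "x \<in> S i" "y \<in> S k"
      obtain a b where ab: "a \<in> S j" "b \<in> S k" "a = b \<or> nearest_neighbors a b"
        and jk: "j \<in> I" "k \<in> I" using link[OF step(2)] by blast
      have "(step_within ?T)\<^sup>*\<^sup>* x a" using step xy ab by blast
      moreover have "(step_within ?T)\<^sup>*\<^sup>* a b"
      proof (cases "a = b")
        case False
        with ab jk have "step_within ?T a b" by (auto simp: step_within_def)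
        then show ?thesis by (rule r_into_rtranclp)
      qed simp
      moreover have "(step_within ?T)\<^sup>*\<^sup>* b y" using inside jk ab xy by blast
      ultimately show "(step_within ?T)\<^sup>*\<^sup>* x y" by (meson rtranclp_trans)
    qed
  qed
  then show ?thesis using reach unfolding connected_sites_def by blast
qed

lemma connected_sites_chain:
  fixes S :: "nat \<Rightarrow> vertex set"
  assumes conn: "\<And>n. connected_sites (S n)" and meet: "\<And>n. S n \<inter> S (Suc n) \<noteq> {}"
  shows "connected_sites (\<Union>n. S n)"
proof (rule connected_sites_UN[where R="\<lambda>m n. n = Suc m \<or> m = Suc n"])
  let ?R = "\<lambda>m n::nat. n = Suc m \<or> m = Suc n"
  have up: "?R\<^sup>*\<^sup>* 0 n" for n
  proof (induction n)
    case (Suc n)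
    then show ?case by (rule rtranclp.rtrancl_into_rtrancl) simp
  qed simp
  have down: "?R\<^sup>*\<^sup>* n 0" for n
  proof (induction n)
    case (Suc n)
    show ?case by (rule converse_rtranclp_into_rtranclp[OF _ Suc]) simp
  qed simp
  show "?R\<^sup>*\<^sup>* m n" for m n using rtranclp_trans[OF down up] .
next
  show "m \<in> UNIV \<and> n \<in> UNIV \<and> (\<exists>x\<in>S m. \<exists>y\<in>S n. x = y \<or> nearest_neighbors x y)"
    if "n = Suc m \<or> m = Suc n" for m n
    using that meet[of m] meet[of n] by blast
qed (use conn in auto)

text \<open>Reachability as a transitive closure gives symmetry, transitivity and invariance of the state
  by induction, which the description by vertex lists makes awkward.\<close>

lemma communicate_iff_rtranclp:
  "communicate c x y \<longleftrightarrow> (\<lambda>u v. nearest_neighbors u v \<and> c u = c v)\<^sup>*\<^sup>* x y"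
proof
  assume "communicate c x y"
  then obtain zs where "zs \<noteq> []" "hd zs = x" "last zs = y"
    "successively nearest_neighbors zs" "\<forall>u\<in>set zs. c u = c x"
    unfolding communicate_def by (metis hd_in_set)
  then show "(\<lambda>u v. nearest_neighbors u v \<and> c u = c v)\<^sup>*\<^sup>* x y"
  proof (induction zs arbitrary: x rule: induct_list012)
    case (3 z z' zs)
    have "(\<lambda>u v. nearest_neighbors u v \<and> c u = c v)\<^sup>*\<^sup>* z' y"
      using "3.prems" by (intro "3.IH"(2)) auto
    moreover have "nearest_neighbors x z' \<and> c x = c z'" using "3.prems" by auto
    ultimately show ?case by (rule converse_rtranclp_into_rtranclp[rotated])
  qed auto
next
  assume "(\<lambda>u v. nearest_neighbors u v \<and> c u = c v)\<^sup>*\<^sup>* x y"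
  then show "communicate c x y"
  proof (induction rule: converse_rtranclp_induct)
    case base
    show ?case unfolding communicate_def by (intro exI[of _ "[y]"]) auto
  next
    case (step x z)
    then obtain zs where zs: "zs \<noteq> []" "hd zs = z" "last zs = y"
      "successively nearest_neighbors zs" "\<forall>u\<in>set zs. c u = c z"
      unfolding communicate_def by (metis hd_in_set)
    have "\<forall>u\<in>set (x # zs). c u = c z" using zs(5) step(1) by auto
    then have "\<forall>u\<in>set (x # zs). \<forall>v\<in>set (x # zs). c u = c v" by metis
    moreover have "successively nearest_neighbors (x # zs)" "last (x # zs) = y"
      using zs(1-4) step(1) by (auto simp: successively_Cons)
    ultimately show ?case unfolding communicate_def
      by (intro exI[of _ "x # zs"] conjI) (simp_all only: list.sel list.distinct not_False_eq_True)
  qed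
qed

lemma communicate_sym: "communicate c x y \<Longrightarrow> communicate c y x"
  unfolding communicate_iff_rtranclp
proof (induction rule: rtranclp_induct)
  case (step y z)
  then show ?case
    by (intro converse_rtranclp_into_rtranclp[OF _ step.IH]) (simp add: nearest_neighbors_sym)
qed simp

lemma communicate_trans: "communicate c x y \<Longrightarrow> communicate c y z \<Longrightarrow> communicate c x z"
  unfolding communicate_iff_rtranclp by (rule rtranclp_trans)

lemma communicate_same_state: "communicate c x y \<Longrightarrow> c x = c y"
  unfolding communicate_iff_rtranclp by (induction rule: rtranclp_induct) auto

lemma connected_component_Collect_communicate: "connected_component c {y. communicate c x y}"
proof -
  have "D = {y. communicate c x y}"
    if "{y. communicate c x y} \<subseteq> D" "\<forall>u\<in>D. \<forall>v\<in>D. communicate c u v" for D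
  proof -
    have "x \<in> D" using that by (auto simp: communicate_iff_rtranclp)
    then show ?thesis using that by auto
  qed
  then show ?thesis unfolding connected_component_def
    by (auto intro: communicate_trans communicate_sym)
qed

definition infinite_cluster_at :: "config \<Rightarrow> vertex \<Rightarrow> bool" where
  "infinite_cluster_at c x \<longleftrightarrow> infinite {y. communicate c x y}"

lemma ex_infinite_open_cluster:
  "c x \<Longrightarrow> infinite_cluster_at c x \<Longrightarrow> \<exists>C. open_cluster c C \<and> infinite C"
  by (intro exI[of _ "{y. communicate c x y}"])
    (auto simp: open_cluster_def infinite_cluster_at_def connected_component_Collect_communicate
      dest: communicate_same_state)

lemma ex_infinite_closed_cluster:
  "\<not> c x \<Longrightarrow> infinite_cluster_at c x \<Longrightarrow> \<exists>C. closed_cluster c C \<and> infinite C"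
  by (intro exI[of _ "{y. communicate c x y}"])
    (auto simp: closed_cluster_def infinite_cluster_at_def connected_component_Collect_communicate
      dest: communicate_same_state)

lemma infinite_cluster_at_connected_sites:
  assumes "connected_sites S" "infinite S" "\<forall>v\<in>S. c v = b" "x \<in> S"
  shows "infinite_cluster_at c x"
proof -
  have "communicate c x y" if "y \<in> S" for y
  proof -
    have "(step_within S)\<^sup>*\<^sup>* x y" using assms that by (auto simp: connected_sites_def)
    then show ?thesis unfolding communicate_iff_rtranclp
      by (rule rtranclp_mono[THEN predicate2D, rotated])
        (use assms(3) in \<open>auto simp: step_within_def\<close>)
  qed
  then show ?thesis unfolding infinite_cluster_at_def
    using assms(2) by (meson finite_subset mem_Collect_eq subsetI)
qed

section \<open>Renormalised blocks\<close>

text \<open>A block of level \<open>k\<close> is a square of side \<open>3 ^ k\<close>, named by its position in the grid of such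
  squares. It consists of nine blocks of level \<open>k - 1\<close>, its children, and it is bad if at least two of
  them are bad. Badness at a level thus costs two disjoint bad events one level below, which makes
  its probability decay doubly exponentially, while a good block still contains a connected set of
  sites off \<open>F\<close>, its backbone, that touches the backbone of every good neighbour. This replaces the
  usual contour argument and needs no planar duality.\<close>

definition parent :: "vertex \<Rightarrow> vertex" where
  "parent b = (fst b div 3, snd b div 3)"

fun bad :: "vertex set \<Rightarrow> nat \<Rightarrow> vertex \<Rightarrow> bool" where
  "bad F 0 b \<longleftrightarrow> b \<in> F"
| "bad F (Suc k) b \<longleftrightarrow>
    (\<exists>b1 b2. parent b1 = b \<and> parent b2 = b \<and> b1 \<noteq> b2 \<and> bad F k b1 \<and> bad F k b2)"

fun backbone :: "vertex set \<Rightarrow> nat \<Rightarrow> vertex \<Rightarrow> vertex set" where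
  "backbone F 0 b = {b}"
| "backbone F (Suc k) b = (\<Union>b'\<in>{b'. parent b' = b \<and> \<not> bad F k b'}. backbone F k b')"

lemma parent_triple [simp]: "s \<in> {0..2} \<Longrightarrow> t \<in> {0..2} \<Longrightarrow> parent (3 * i + s, 3 * j + t) = (i, j)"
  by (auto simp: parent_def)

lemma parent_eq_iff:
  "parent b = (i, j) \<longleftrightarrow> (\<exists>s\<in>{0..2}. \<exists>t\<in>{0..2}. b = (3 * i + s, 3 * j + t))"
proof
  assume "parent b = (i, j)"
  then show "\<exists>s\<in>{0..2}. \<exists>t\<in>{0..2}. b = (3 * i + s, 3 * j + t)"
    by (intro bexI[of _ "fst b mod 3"] bexI[of _ "snd b mod 3"])
      (auto simp: parent_def prod_eq_iff)
qed auto

lemma backbone_subset_block: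
  "v \<in> backbone F k b \<Longrightarrow> fst v div 3 ^ k = fst b \<and> snd v div 3 ^ k = snd b"
proof (induction k arbitrary: b)
  case (Suc k)
  then obtain b' where b': "parent b' = b" "v \<in> backbone F k b'" by auto
  with Suc.IH show ?case by (auto simp: parent_def power_Suc2 zdiv_zmult2_eq simp del: power_Suc)
qed auto

lemma backbone_disjoint: "\<not> bad F k b \<Longrightarrow> backbone F k b \<inter> F = {}"
  by (induction k arbitrary: b) auto

lemma bad_child_unique:
  "\<not> bad F (Suc k) b \<Longrightarrow> parent a = b \<Longrightarrow> parent a' = b \<Longrightarrow> bad F k a \<Longrightarrow> bad F k a' \<Longrightarrow> a = a'"
  unfolding bad.simps by blast

text \<open>A good child cannot share both its row and its column with the bad one, of which there is at most
  one, and a row or column that avoids the bad child is entirely good.\<close>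

lemma good_row_or_column:
  assumes "\<not> bad F (Suc k) b" "parent a = b" "\<not> bad F k a"
  shows "(\<forall>a'. parent a' = b \<and> fst a' = fst a \<longrightarrow> \<not> bad F k a') \<or>
         (\<forall>a'. parent a' = b \<and> snd a' = snd a \<longrightarrow> \<not> bad F k a')"
  using bad_child_unique[OF assms(1)] assms(3) by (metis prod_eqI)


lemma step_within_sym: "(step_within S)\<^sup>*\<^sup>* x y \<Longrightarrow> (step_within S)\<^sup>*\<^sup>* y x"
  by (rule sympD[OF symp_rtranclp])
    (auto simp: symp_def step_within_def nearest_neighbors_sym)

lemma step_within_row:
  assumes "\<And>t. lo \<le> t \<Longrightarrow> t \<le> hi \<Longrightarrow> (t, j) \<in> S" "s \<in> {lo..hi}" "t \<in> {lo..hi}"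
  shows "(step_within S)\<^sup>*\<^sup>* (s, j) (t, j)"
proof -
  have up: "(step_within S)\<^sup>*\<^sup>* (s, j) (t, j)" if "lo \<le> s" "s \<le> t" "t \<le> hi" for s t
    using that(2,3)
  proof (induction t rule: int_ge_induct)
    case (step t)
    show ?case
      by (rule rtranclp.rtrancl_into_rtrancl[OF step.IH])
        (use step that(1) assms(1) in \<open>auto simp: step_within_def nearest_neighbors_def\<close>)
  qed simp
  then show ?thesis using assms(2,3) step_within_sym[OF up]
    by (metis atLeastAtMost_iff linear)
qed

lemma step_within_column:
  assumes "\<And>t. lo \<le> t \<Longrightarrow> t \<le> hi \<Longrightarrow> (i, t) \<in> S" "s \<in> {lo..hi}" "t \<in> {lo..hi}"
  shows "(step_within S)\<^sup>*\<^sup>* (i, s) (i, t)"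
proof -
  have up: "(step_within S)\<^sup>*\<^sup>* (i, s) (i, t)" if "lo \<le> s" "s \<le> t" "t \<le> hi" for s t
    using that(2,3)
  proof (induction t rule: int_ge_induct)
    case (step t)
    show ?case
      by (rule rtranclp.rtrancl_into_rtrancl[OF step.IH])
        (use step that(1) assms(1) in \<open>auto simp: step_within_def nearest_neighbors_def\<close>)
  qed simp
  then show ?thesis using assms(2,3) step_within_sym[OF up]
    by (metis atLeastAtMost_iff linear)
qed

text \<open>By \<open>good_row_or_column\<close> every good child lies in an entirely good row or column. As at most one of the
  children is bad, some row and some column of the block are entirely good as well; they cross in a
  hub, and a full row meets the full column while a full column meets the full row.\<close>

lemma connected_sites_good_children:
  assumes good: "\<not> bad F (Suc k) b"
  shows "connected_sites {b'. parent b' = b \<and> \<not> bad F k b'}" (is "connected_sites ?G")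
proof -
  obtain i j where b: "b = (i, j)" by force
  have unique: "a = a'" if "parent a = b" "parent a' = b" "bad F k a" "bad F k a'" for a a'
    using bad_child_unique[OF good] that by blast
  have "\<exists>s\<in>{0,1}. \<forall>t. t \<in> {0..2} \<longrightarrow> (3 * i + s, 3 * j + t) \<in> ?G"
  proof (rule ccontr)
    assume "\<not> ?thesis"
    then obtain t t' where "t \<in> {0..2}" "t' \<in> {0..2}" "bad F k (3 * i + 0, 3 * j + t)"
      "bad F k (3 * i + 1, 3 * j + t')"
      using b parent_triple[of 0 _ i j] parent_triple[of 1 _ i j] by auto
    then show False using unique[of "(3 * i + 0, 3 * j + t)" "(3 * i + 1, 3 * j + t')"]
        parent_triple[of 0 t i j] parent_triple[of 1 t' i j] b by simp
  qed
  then obtain s0 where s0': "s0 \<in> {0, 1}" "\<forall>t. t \<in> {0..2} \<longrightarrow> (3 * i + s0, 3 * j + t) \<in> ?G" ..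
  then have s0: "s0 \<in> {0..2}" "\<And>t. t \<in> {0..2} \<Longrightarrow> (3 * i + s0, 3 * j + t) \<in> ?G" by fastforce+
  have "\<exists>t\<in>{0,1}. \<forall>s. s \<in> {0..2} \<longrightarrow> (3 * i + s, 3 * j + t) \<in> ?G"
  proof (rule ccontr)
    assume "\<not> ?thesis"
    then obtain s s' where "s \<in> {0..2}" "s' \<in> {0..2}" "bad F k (3 * i + s, 3 * j + 0)"
      "bad F k (3 * i + s', 3 * j + 1)"
      using b parent_triple[of _ 0 i j] parent_triple[of _ 1 i j] by auto
    then show False using unique[of "(3 * i + s, 3 * j + 0)" "(3 * i + s', 3 * j + 1)"]
        parent_triple[of s 0 i j] parent_triple[of s' 1 i j] b by simp
  qed
  then obtain t0 where t0': "t0 \<in> {0, 1}" "\<forall>s. s \<in> {0..2} \<longrightarrow> (3 * i + s, 3 * j + t0) \<in> ?G" ..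
  then have t0: "t0 \<in> {0..2}" "\<And>s. s \<in> {0..2} \<Longrightarrow> (3 * i + s, 3 * j + t0) \<in> ?G" by fastforce+
  have row: "(step_within ?G)\<^sup>*\<^sup>* (3 * i + s, 3 * j + t) (3 * i + s', 3 * j + t)"
    if "\<And>s. s \<in> {0..2} \<Longrightarrow> (3 * i + s, 3 * j + t) \<in> ?G" "s \<in> {0..2}" "s' \<in> {0..2}" for s s' t
  proof (rule step_within_row[of "3 * i" "3 * i + 2"])
    fix r assume "3 * i \<le> r" "r \<le> 3 * i + 2"
    then show "(r, 3 * j + t) \<in> ?G" using that(1)[of "r - 3 * i"] by auto
  qed (use that in auto)
  have col: "(step_within ?G)\<^sup>*\<^sup>* (3 * i + s, 3 * j + t) (3 * i + s, 3 * j + t')"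
    if "\<And>t. t \<in> {0..2} \<Longrightarrow> (3 * i + s, 3 * j + t) \<in> ?G" "t \<in> {0..2}" "t' \<in> {0..2}" for s t t'
  proof (rule step_within_column[of "3 * j" "3 * j + 2"])
    fix r assume "3 * j \<le> r" "r \<le> 3 * j + 2"
    then show "(3 * i + s, r) \<in> ?G" using that(1)[of "r - 3 * j"] by auto
  qed (use that in auto)
  have hub: "(step_within ?G)\<^sup>*\<^sup>* a (3 * i + s0, 3 * j + t0)" if a: "a \<in> ?G" for a
  proof -
    obtain s t where st: "s \<in> {0..2}" "t \<in> {0..2}" "a = (3 * i + s, 3 * j + t)"
      using a parent_eq_iff[of a i j] b by blast
    consider "\<And>t. t \<in> {0..2} \<Longrightarrow> (3 * i + s, 3 * j + t) \<in> ?G"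
      | "\<And>s. s \<in> {0..2} \<Longrightarrow> (3 * i + s, 3 * j + t) \<in> ?G"
      using good_row_or_column[OF good, of a] a st b by auto
    then show ?thesis
    proof cases
      case 1
      show ?thesis unfolding st
        by (rule rtranclp_trans[OF col[OF 1 st(2) t0(1)] row[OF t0(2) st(1) s0(1)]])
    next
      case 2
      show ?thesis unfolding st
        by (rule rtranclp_trans[OF row[OF 2 st(1) s0(1)] col[OF s0(2) st(2) t0(1)]])
    qed
  qed
  show ?thesis unfolding connected_sites_def
    by (intro ballI) (rule rtranclp_trans[OF hub step_within_sym[OF hub]])
qed

lemma good_adjacent_children:
  assumes "nearest_neighbors b b'" "\<not> bad F (Suc k) b" "\<not> bad F (Suc k) b'"
  shows "\<exists>a a'. parent a = b \<and> parent a' = b' \<and> \<not> bad F k a \<and> \<not> bad F k a' \<and> nearest_neighbors a a'"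
proof -
  \<comment> \<open>Three disjoint pairs of facing children join the two blocks; each block spoils at most one.\<close>
  have three: ?thesis
    if "\<And>t. t \<in> {0,1,2} \<Longrightarrow> parent (f t) = b \<and> parent (f' t) = b' \<and> nearest_neighbors (f t) (f' t)"
      "inj_on f {0,1,2}" "inj_on f' {0,1,2}" for f f' :: "int \<Rightarrow> vertex"
  proof -
    have *: "card {t\<in>{0,1,2}. bad F k (g t)} \<le> 1"
      if "inj_on g {0,1,2}" and g: "\<And>t. t \<in> {0,1,2} \<Longrightarrow> parent (g t) = c" and "\<not> bad F (Suc k) c"
      for g :: "int \<Rightarrow> vertex" and c
    proof -
      have "t = t'" if "t \<in> {0,1,2}" "t' \<in> {0,1,2}" "bad F k (g t)" "bad F k (g t')" for t t'
        by (rule inj_onD[OF \<open>inj_on g {0,1,2}\<close> bad_child_unique[OF \<open>\<not> bad F (Suc k) c\<close>]])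
          (rule g that)+
      then have "\<forall>t\<in>{t\<in>{0,1,2}. bad F k (g t)}. \<forall>t'\<in>{t\<in>{0,1,2}. bad F k (g t)}. t = t'" by blast
      moreover have "finite {t\<in>{0,1,2}. bad F k (g t)}" by (rule finite_subset[of _ "{0,1,2}"]) auto
      ultimately show ?thesis unfolding One_nat_def using card_le_Suc0_iff_eq by blast
    qed
    define A where "A = {t\<in>{0,1,2}. bad F k (f t)}"
    define B where "B = {t\<in>{0,1,2}. bad F k (f' t)}"
    have "card A \<le> 1" "card B \<le> 1"
      unfolding A_def B_def using *[of f b] *[of f' b'] that assms(2,3) by blast+
    then have "card (A \<union> B) < card {0,1,2::int}" using card_Un_le[of A B] by simp
    then have "\<not> {0,1,2} \<subseteq> A \<union> B"
      using card_mono[of "A \<union> B" "{0,1,2}"] by (auto simp: A_def B_def not_less)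
    then obtain t where "t \<in> {0,1,2}" "\<not> bad F k (f t)" "\<not> bad F k (f' t)"
      unfolding A_def B_def by blast
    then show ?thesis using that(1) by blast
  qed
  obtain i j where b: "b = (i, j)" by force
  obtain i' j' where b': "b' = (i', j')" by force
  have "\<bar>i - i'\<bar> + \<bar>j - j'\<bar> = 1" using assms(1) by (simp add: nearest_neighbors_def b b')
  then have "i' = i + 1 \<and> j' = j \<or> i' = i - 1 \<and> j' = j \<or> i' = i \<and> j' = j + 1 \<or> i' = i \<and> j' = j - 1"
    by arith
  then consider "b' = (i + 1, j)" | "b' = (i - 1, j)" | "b' = (i, j + 1)" | "b' = (i, j - 1)"
    using b' by blast
  then show ?thesis
  proof cases
    case 1
    show ?thesis
      by (rule three[of "\<lambda>t. (3 * i + 2, 3 * j + t)" "\<lambda>t. (3 * i + 3, 3 * j + t)"])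
        (auto simp: parent_def b 1 nearest_neighbors_def inj_on_def)
  next
    case 2
    show ?thesis
      by (rule three[of "\<lambda>t. (3 * i, 3 * j + t)" "\<lambda>t. (3 * i - 1, 3 * j + t)"])
        (auto simp: parent_def b 2 nearest_neighbors_def inj_on_def)
  next
    case 3
    show ?thesis
      by (rule three[of "\<lambda>t. (3 * i + t, 3 * j + 2)" "\<lambda>t. (3 * i + t, 3 * j + 3)"])
        (auto simp: parent_def b 3 nearest_neighbors_def inj_on_def)
  next
    case 4
    show ?thesis
      by (rule three[of "\<lambda>t. (3 * i + t, 3 * j)" "\<lambda>t. (3 * i + t, 3 * j - 1)"])
        (auto simp: parent_def b 4 nearest_neighbors_def inj_on_def)
  qed
qed

lemma backbone_linked:
  assumes "nearest_neighbors b b'" "\<not> bad F k b" "\<not> bad F k b'"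
  shows "\<exists>x\<in>backbone F k b. \<exists>y\<in>backbone F k b'. nearest_neighbors x y"
  using assms
proof (induction k arbitrary: b b')
  case (Suc k)
  obtain a a' where "parent a = b" "parent a' = b'" "\<not> bad F k a" "\<not> bad F k a'" "nearest_neighbors a a'"
    using good_adjacent_children[OF Suc.prems] by blast
  with Suc.IH[of a a'] show ?case unfolding backbone.simps by blast
qed auto

text \<open>Inside a good block the good children are connected as cells, and neighbouring good
  children have touching backbones, so the gluing principle applies at every level.\<close>

lemma backbone_connected_nonempty:
  assumes "\<not> bad F k b"
  shows "connected_sites (backbone F k b) \<and> backbone F k b \<noteq> {}"
  using assms
proof (induction k arbitrary: b)
  case (Suc k)
  let ?G = "{b'. parent b' = b \<and> \<not> bad F k b'}"
  have "connected_sites (\<Union>b'\<in>?G. backbone F k b')"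
  proof (rule connected_sites_UN[where R="step_within ?G"])
    fix c d assume "step_within ?G c d"
    then show "c \<in> ?G \<and> d \<in> ?G \<and>
      (\<exists>x\<in>backbone F k c. \<exists>y\<in>backbone F k d. x = y \<or> nearest_neighbors x y)"
      using backbone_linked[of c d F k] by (auto simp: step_within_def)
  qed (use Suc.IH connected_sites_good_children[OF Suc.prems] in \<open>auto simp: connected_sites_def\<close>)
  moreover obtain a where "parent a = b" "\<not> bad F k a"
  proof -
    have "parent (3 * fst b, 3 * snd b) = b" "parent (3 * fst b + 1, 3 * snd b) = b"
      by (auto simp: parent_def)
    with Suc.prems that show ?thesis by fastforce
  qed
  ultimately show ?case using Suc.IH[of a] unfolding backbone.simps by blast
qed (auto simp: connected_sites_def)

lemma connected_sites_backbones:
  assumes "connected_sites J" "\<And>b. b \<in> J \<Longrightarrow> \<not> bad F k b"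
  shows "connected_sites (\<Union>b\<in>J. backbone F k b)"
proof (rule connected_sites_UN[where R="step_within J"])
  fix c d assume "step_within J c d"
  then show "c \<in> J \<and> d \<in> J \<and>
    (\<exists>x\<in>backbone F k c. \<exists>y\<in>backbone F k d. x = y \<or> nearest_neighbors x y)"
    using backbone_linked[of c d F k] assms(2) by (auto simp: step_within_def)
qed (use assms backbone_connected_nonempty in \<open>auto simp: connected_sites_def\<close>)

section \<open>The hierarchy of stripes\<close>

text \<open>Stripes of level \<open>n\<close> are horizontal for even \<open>n\<close> and vertical for odd \<open>n\<close>. They have width
  \<open>2 * 3 ^ n\<close>, so that each contains a full row of blocks of level \<open>n\<close> wherever the stripe happens to
  lie, and open and closed stripes alternate, \<open>half_period n\<close> apart. The exponent is quadratic in
  \<open>n\<close> so that the ratios of successive periods are summable even after multiplication by the width;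
  it must stay far below \<open>2 ^ n\<close> for the block estimate to win.\<close>

definition half_period :: "nat \<Rightarrow> int" where
  "half_period n = 4 ^ ((n + 1)\<^sup>2)"

abbreviation period :: "nat \<Rightarrow> int" where
  "period n \<equiv> 2 * half_period n"

definition stripe_width :: "nat \<Rightarrow> int" where
  "stripe_width n = 2 * 3 ^ n"

definition in_stripe :: "nat \<Rightarrow> int \<Rightarrow> bool \<Rightarrow> int \<Rightarrow> bool" where
  "in_stripe n s c t \<longleftrightarrow> (t + s - (if c then 0 else half_period n)) mod period n < stripe_width n"

definition stripe_coord :: "nat \<Rightarrow> vertex \<Rightarrow> int" where
  "stripe_coord n v = (if even n then snd v else fst v)"

definition stripe :: "(nat \<Rightarrow> int) \<Rightarrow> nat \<Rightarrow> bool \<Rightarrow> vertex \<Rightarrow> bool" where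
  "stripe u n c v \<longleftrightarrow> in_stripe n (u n) c (stripe_coord n v)"

text \<open>The stripe of highest level decides; a site in no stripe, or in stripes of unboundedly many levels,
  is closed.\<close>

definition stripe_state :: "(nat \<Rightarrow> int) \<Rightarrow> config" where
  "stripe_state u v \<longleftrightarrow> (\<exists>n. stripe u n True v \<and> (\<forall>m>n. \<forall>c. \<not> stripe u m c v))"

lemma half_period_pos: "0 < half_period n"
  by (simp add: half_period_def)

lemma width_le_half_period: "stripe_width n \<le> half_period n"
proof -
  have "2 * (3::int) ^ n \<le> 2 * 4 ^ n" by (simp add: power_mono)
  also have "\<dots> \<le> 4 ^ Suc n" by simp
  also have "\<dots> \<le> 4 ^ ((n + 1)\<^sup>2)" by (intro power_increasing) (auto simp: power2_eq_square)
  finally show ?thesis by (simp add: stripe_width_def half_period_def)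
qed

lemma half_period_ge: "int n < half_period n"
proof -
  have "n < 4 ^ n" by (rule less_exp[THEN less_le_trans]) (simp add: power_mono)
  then have "int n < 4 ^ n" by (metis of_nat_less_iff of_nat_numeral of_nat_power)
  also have "(4::int) ^ n \<le> 4 ^ ((n + 1)\<^sup>2)"
    by (intro power_increasing) (auto simp: power2_eq_square)
  finally show ?thesis by (simp add: half_period_def)
qed

lemma period_Suc: "period n + 3 ^ Suc n \<le> period (Suc n)"
proof -
  have "(4::int) * 4 ^ ((n + 1)\<^sup>2) \<le> 4 ^ ((n + 2)\<^sup>2)"
    unfolding power_Suc[symmetric] by (intro power_increasing) (auto simp: power2_eq_square)
  then have "4 * half_period n \<le> half_period (Suc n)" by (simp add: half_period_def)
  moreover have "2 * 3 ^ n \<le> half_period n"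
    using width_le_half_period[of n] by (simp add: stripe_width_def)
  moreover have "(0::int) < 3 ^ n" by simp
  ultimately show ?thesis unfolding power_Suc by linarith
qed

lemma period_mono: "m \<le> n \<Longrightarrow> period m \<le> period n"
proof (rule lift_Suc_mono_le)
  show "period n \<le> period (Suc n)" for n
    using period_Suc[of n] by (smt (verit) zero_less_power)
qed

text \<open>Levels below \<open>n\<close> are overruled by the stripe of level \<open>n\<close>. Among the higher levels only
  \<open>n + 1\<close> may have a stripe through \<open>v\<close>, and one of the same state, so it does no harm.\<close>

lemma stripe_state_eqI:
  assumes "stripe u n c v" "\<And>m. n \<le> m \<Longrightarrow> \<not> stripe u m (\<not> c) v"
    "\<And>m. n + 2 \<le> m \<Longrightarrow> \<not> stripe u m c v"
  shows "stripe_state u v = c"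
proof -
  obtain k where k: "n \<le> k" "stripe u k c v" "\<And>m. k < m \<Longrightarrow> \<not> stripe u m c v"
  proof (cases "stripe u (Suc n) c v")
    case True
    then show ?thesis using that[of "Suc n"] assms(3) by auto
  next
    case False
    have "\<not> stripe u m c v" if "n < m" for m
      using that False assms(3)[of m] by (cases "m = Suc n") auto
    then show ?thesis using that[of n] assms(1) by auto
  qed
  show ?thesis
  proof (cases c)
    case True
    have "\<not> stripe u m c' v" if "k < m" for m c'
      using that assms(2)[of m] k(1) k(3)[of m] True by (cases c') auto
    then show ?thesis unfolding stripe_state_def using True k(2) by auto
  next
    case False
    have "\<not> stripe_state u v"
    proof
      assume "stripe_state u v"
      then obtain j where "stripe u j True v" "\<And>m c. j < m \<Longrightarrow> \<not> stripe u m c v"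
        unfolding stripe_state_def by blast
      moreover have "j < n" using assms(2)[of j] calculation(1) False not_le by auto
      ultimately show False using assms(1) by blast
    qed
    then show ?thesis using False by simp
  qed
qed

text \<open>The origin sees no stripe of level \<open>n + 1\<close> on the scale of level \<open>n\<close>; the probability that this fails is
  summable in \<open>n\<close>.\<close>

definition clear :: "(nat \<Rightarrow> int) \<Rightarrow> nat \<Rightarrow> bool" where
  "clear u n \<longleftrightarrow> (\<forall>c t. \<bar>t\<bar> \<le> period n \<longrightarrow> \<not> in_stripe (Suc n) (u (Suc n)) c t)"

lemma in_stripe_not:
  "in_stripe n s (\<not> c) t \<longleftrightarrow>
    (t + s - (if c then 0 else half_period n) - half_period n) mod period n < stripe_width n"
proof -
  have "(t + s) mod period n = (t + s - period n) mod period n"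
    by (simp add: mod_diff_right_eq[symmetric])
  then show ?thesis by (auto simp: in_stripe_def algebra_simps)
qed

text \<open>Seen from the origin, the nearest stripe of level \<open>n + 1\<close> on one side is open and on the other side
  it is closed. Hence for either state \<open>c\<close> one can walk to a stripe of that state without crossing
  one of the opposite state. The interval from \<open>lo\<close> to \<open>hi\<close> is the range that is free of the
  opposite state, and \<open>a\<close> is where the stripe begins.\<close>

lemma corridor:
  assumes "clear u n"
  obtains lo hi a where
    "- period (Suc n) \<le> lo" "lo \<le> - period n" "period n \<le> hi" "hi \<le> period (Suc n)"
    "lo \<le> a" "a + stripe_width (Suc n) \<le> hi + 1"
    "\<And>t. t \<in> {lo..hi} \<Longrightarrow> \<not> in_stripe (Suc n) (u (Suc n)) (\<not> c) t"
    "\<And>t. t \<in> {a..<a + stripe_width (Suc n)} \<Longrightarrow> in_stripe (Suc n) (u (Suc n)) c t"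
proof -
  define H where "H = half_period (Suc n)"
  define W where "W = stripe_width (Suc n)"
  define R where "R = period n"
  define r where "r = (u (Suc n) - (if c then 0 else H)) mod (2 * H)"
  have W: "0 < W" "W \<le> H" using width_le_half_period[of "Suc n"]
    by (auto simp: W_def H_def stripe_width_def)
  have r: "0 \<le> r" "r < 2 * H" using W by (auto simp: r_def)
  have R: "0 \<le> R" using half_period_pos[of n] by (simp add: R_def)
  have same: "in_stripe (Suc n) (u (Suc n)) c t \<longleftrightarrow> (t + r) mod (2 * H) < W" for t
    unfolding in_stripe_def r_def H_def[symmetric] W_def[symmetric]
    by (simp add: mod_simps algebra_simps)
  have other: "in_stripe (Suc n) (u (Suc n)) (\<not> c) t \<longleftrightarrow> (t + r - H) mod (2 * H) < W" for t
  proof -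
    have "(t + r - H) mod (2 * H) = (t - H + r) mod (2 * H)" by (simp add: algebra_simps)
    also have "\<dots> = (t - H + (u (Suc n) - (if c then 0 else H))) mod (2 * H)"
      unfolding r_def by (rule mod_add_right_eq)
    also have "\<dots> = (t + u (Suc n) - (if c then 0 else H) - H) mod (2 * H)"
      by (simp add: algebra_simps)
    finally show ?thesis unfolding in_stripe_not H_def[symmetric] W_def[symmetric] by simp
  qed
  have no_same: "\<not> (t + r) mod (2 * H) < W" and no_other: "\<not> (t + r - H) mod (2 * H) < W"
    if "- R \<le> t" "t \<le> R" for t
    using assms that same[of t] other[of t] by (auto simp: clear_def R_def)
  \<comment> \<open>After the shift by \<open>r\<close> the origin sits at position \<open>r\<close> of a period that starts with a stripe of
    state \<open>c\<close> and has the opposite stripe at \<open>H\<close>; the two halves decide on which side the stripe is.\<close>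
  show thesis
  proof (cases "r < H")
    case True
    have "- r < - R"
      using no_same[of "- r"] W R r by fastforce
    moreover have "R < H - r"
      using no_other[of "H - r"] W R True by fastforce
    ultimately show thesis
    proof (intro that[of "- r" "H - r - 1" "- r"])
      show "\<not> in_stripe (Suc n) (u (Suc n)) (\<not> c) t" if "t \<in> {- r..H - r - 1}" for t
      proof -
        have "(t + r - H) mod (2 * H) = (t + r + H) mod (2 * H)"
          using mod_add_self2[of "t + r - H" "2 * H"] by (simp add: algebra_simps)
        also have "\<dots> = t + r + H" using that by (intro mod_pos_pos_trivial) auto
        finally show ?thesis unfolding other using that W by auto
      qed
      show "in_stripe (Suc n) (u (Suc n)) c t" if "t \<in> {- r..<- r + stripe_width (Suc n)}" for t
      proof -
        have "(t + r) mod (2 * H) = t + r"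
          using that W by (intro mod_pos_pos_trivial) (auto simp: W_def)
        then show ?thesis unfolding same using that by (auto simp: W_def)
      qed
    qed (use r W True in \<open>auto simp: H_def[symmetric] W_def[symmetric] R_def[symmetric]\<close>)
  next
    case False
    have "R < 2 * H - r"
      using no_same[of "2 * H - r"] W R r by fastforce
    moreover have "H - r + W \<le> - R"
    proof (rule ccontr)
      assume *: "\<not> ?thesis"
      show False
      proof (cases "H - r < - R")
        case True
        have "(- R + r - H) mod (2 * H) = - R + r - H"
          using True r R by (intro mod_pos_pos_trivial) auto
        then show False using no_other[of "- R"] R * by auto
      next
        case ge: False
        show False using no_other[of "H - r"] ge False R W by fastforce
      qed
    qed
    ultimately show thesis
    proof (intro that[of "H - r + W" "2 * H - r + W - 1" "2 * H - r"])
      show "\<not> in_stripe (Suc n) (u (Suc n)) (\<not> c) t" if "t \<in> {H - r + W..2 * H - r + W - 1}" for t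
      proof (cases "t + r - H < 2 * H")
        case True
        then have "(t + r - H) mod (2 * H) = t + r - H"
          using that W by (intro mod_pos_pos_trivial) auto
        then show ?thesis unfolding other using that by auto
      qed (use that W in auto)
      show "in_stripe (Suc n) (u (Suc n)) c t"
        if "t \<in> {2 * H - r..<2 * H - r + stripe_width (Suc n)}" for t
      proof -
        have "(t + r) mod (2 * H) = (t + r - 2 * H) mod (2 * H)" by simp
        also have "\<dots> = t + r - 2 * H"
          using that W by (intro mod_pos_pos_trivial) (auto simp: W_def)
        finally show ?thesis unfolding same using that by (auto simp: W_def)
      qed
    qed (use r W False in \<open>auto simp: H_def[symmetric] W_def[symmetric] R_def[symmetric]\<close>)
  qed
qed

text \<open>The radius is the reach of the corridors of level \<open>n + 1\<close>, along which the blocks of level \<open>n\<close>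
  have to be good.\<close>

definition quiet :: "vertex set \<Rightarrow> nat \<Rightarrow> bool" where
  "quiet F n \<longleftrightarrow>
    (\<forall>b. \<bar>fst b\<bar> \<le> period (Suc n) \<and> \<bar>snd b\<bar> \<le> period (Suc n) \<longrightarrow> \<not> bad F n b)"

definition noisy_state :: "(nat \<Rightarrow> int) \<Rightarrow> vertex set \<Rightarrow> config" where
  "noisy_state u F v \<longleftrightarrow> (stripe_state u v \<noteq> (v \<in> F))"

lemma stripe_coord_add2 [simp]: "stripe_coord (Suc (Suc n)) v = stripe_coord n v"
  by (simp add: stripe_coord_def)

lemma stripe_coord_parent: "stripe_coord n (parent b) = stripe_coord n b div 3"
  by (simp add: stripe_coord_def parent_def)

lemma connected_sites_block_strip:
  fixes q :: int
  assumes "0 < q"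
  shows "connected_sites {b. stripe_coord n b = i \<and> lo \<le> q * stripe_coord (Suc n) b \<and>
    q * stripe_coord (Suc n) b \<le> hi}" (is "connected_sites ?J")
  unfolding connected_sites_def
proof (intro ballI)
  fix b b' assume J: "b \<in> ?J" "b' \<in> ?J"
  let ?t = "stripe_coord (Suc n) b" and ?t' = "stripe_coord (Suc n) b'"
  have mid: "lo \<le> q * t \<and> q * t \<le> hi" if "min ?t ?t' \<le> t" "t \<le> max ?t ?t'" for t
  proof -
    have "q * min ?t ?t' \<le> q * t" "q * t \<le> q * max ?t ?t'"
      using that assms by (auto intro!: mult_left_mono)
    then show ?thesis using J by (auto simp: min_def max_def split: if_splits)
  qed
  show "(step_within ?J)\<^sup>*\<^sup>* b b'"
  proof (cases "even n")
    case True
    have "b = (?t, i)" "b' = (?t', i)" using J True by (auto simp: stripe_coord_def prod_eq_iff)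
    moreover have "(step_within ?J)\<^sup>*\<^sup>* (?t, i) (?t', i)"
      by (rule step_within_row[of "min ?t ?t'" "max ?t ?t'"])
        (use mid True in \<open>auto simp: stripe_coord_def\<close>)
    ultimately show ?thesis by simp
  next
    case False
    have "b = (i, ?t)" "b' = (i, ?t')" using J False by (auto simp: stripe_coord_def prod_eq_iff)
    moreover have "(step_within ?J)\<^sup>*\<^sup>* (i, ?t) (i, ?t')"
      by (rule step_within_column[of "min ?t ?t'" "max ?t ?t'"])
        (use mid False in \<open>auto simp: stripe_coord_def\<close>)
    ultimately show ?thesis by simp
  qed
qed

text \<open>If from some scale on the stripes stay clear of the origin and the blocks are good, then both states
  have infinite clusters. For the state \<open>c\<close>, take at each level \<open>n\<close> the stripe that \<open>corridor\<close> supplies, and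
  in it the row of blocks of level \<open>n\<close> (the index \<open>i n\<close>) along the corridor of level \<open>n + 1\<close>: no
  stripe of the opposite state and of level \<open>n + 1\<close> or higher interrupts it. The backbones \<open>A n\<close> of this
  row have state \<open>c\<close>. The row meets the stripe chosen at level \<open>n + 1\<close>, which is perpendicular to it, so
  the two share a block of level \<open>n\<close>, and \<open>A n\<close> meets \<open>A (Suc n)\<close>. The union of all \<open>A n\<close> is connected and unbounded.\<close>

proposition infinite_cluster_of_stripes:
  assumes clear: "\<And>n. n \<ge> N \<Longrightarrow> clear u n" and quiet: "\<And>n. n \<ge> N \<Longrightarrow> quiet F n"
  shows "\<exists>x. noisy_state u F x = c \<and> infinite_cluster_at (noisy_state u F) x"
proof -
  have "\<exists>lo hi a. n > N \<longrightarrow> - period n \<le> lo \<and> lo \<le> - period (n - 1) \<and> period (n - 1) \<le> hi \<and>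
      hi \<le> period n \<and> lo \<le> a \<and> a + stripe_width n \<le> hi + 1 \<and>
      (\<forall>t\<in>{lo..hi}. \<not> in_stripe n (u n) (\<not> c) t) \<and>
      (\<forall>t\<in>{a..<a + stripe_width n}. in_stripe n (u n) c t)" for n
  proof (cases n)
    case (Suc m)
    show ?thesis
    proof (cases "n > N")
      case True
      then show ?thesis
        using corridor[OF clear[of m], of c] Suc by (metis diff_Suc_1 less_Suc_eq_le)
    qed auto
  qed auto
  then obtain lo hi a where corr: "\<And>n. n > N \<Longrightarrow> - period n \<le> lo n \<and> lo n \<le> - period (n - 1) \<and>
      period (n - 1) \<le> hi n \<and>
      hi n \<le> period n \<and> lo n \<le> a n \<and> a n + stripe_width n \<le> hi n + 1 \<and>
      (\<forall>t\<in>{lo n..hi n}. \<not> in_stripe n (u n) (\<not> c) t) \<and>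
      (\<forall>t\<in>{a n..<a n + stripe_width n}. in_stripe n (u n) c t)"
    by metis
  \<comment> \<open>Rounding \<open>a n / 3 ^ n\<close> up leaves a whole block inside the stripe, as the width is two blocks.\<close>
  define i where "i n = - ((- a n) div 3 ^ n)" for n
  have i: "a n \<le> 3 ^ n * i n" "3 ^ n * i n + 3 ^ n \<le> a n + stripe_width n" for n
  proof -
    have "(- a n) mod 3 ^ n < 3 ^ n" "0 \<le> (- a n) mod 3 ^ n" by simp_all
    moreover have "3 ^ n * ((- a n) div 3 ^ n) + (- a n) mod 3 ^ n = - a n"
      by (rule mult_div_mod_eq)
    moreover have "3 ^ n * i n = - (3 ^ n * ((- a n) div 3 ^ n))" by (simp add: i_def)
    ultimately show "a n \<le> 3 ^ n * i n" "3 ^ n * i n + 3 ^ n \<le> a n + stripe_width n"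
      unfolding stripe_width_def by linarith+
  qed
  define J where "J n = {b. stripe_coord n b = i n \<and>
    lo (Suc n) \<le> 3 ^ n * stripe_coord (Suc n) b \<and>
    3 ^ n * stripe_coord (Suc n) b \<le> hi (Suc n) + 1 - 3 ^ n}" for n
  define A where "A n = (\<Union>b\<in>J n. backbone F n b)" for n
  have abs_le: "\<bar>t\<bar> \<le> p" if "- p \<le> 3 ^ n * t" "3 ^ n * t \<le> p" for t p :: int and n
  proof -
    have "\<bar>t\<bar> * 1 \<le> \<bar>t\<bar> * 3 ^ n" by (intro mult_left_mono) auto
    also have "\<dots> = \<bar>3 ^ n * t\<bar>" by (simp add: abs_mult mult.commute)
    finally show ?thesis using that by auto
  qed
  have pow: "(1::int) \<le> 3 ^ n" for n by simp
  have i_bounds: "lo n \<le> 3 ^ n * i n" "3 ^ n * i n + 3 ^ n \<le> hi n + 1" if "n > N" for n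
    using corr[OF that] i[of n] by auto
  have good: "\<not> bad F n b" if "n > N" "b \<in> J n" for n b
  proof -
    have "\<bar>stripe_coord n b\<bar> \<le> period n"
      using abs_le[of "period n" n "i n"] i_bounds[OF that(1)] corr[OF that(1)] that(2) pow[of n]
      by (auto simp: J_def)
    then have "\<bar>stripe_coord n b\<bar> \<le> period (Suc n)" using period_mono[of n "Suc n"] by simp
    moreover have "\<bar>stripe_coord (Suc n) b\<bar> \<le> period (Suc n)"
    proof (rule abs_le[of _ n])
      have "- period (Suc n) \<le> lo (Suc n)" "hi (Suc n) \<le> period (Suc n)"
        using corr[of "Suc n"] that(1) by auto
      moreover have "lo (Suc n) \<le> 3 ^ n * stripe_coord (Suc n) b"
        "3 ^ n * stripe_coord (Suc n) b \<le> hi (Suc n) + 1 - 3 ^ n" using that(2) by (auto simp: J_def)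
      ultimately show "- period (Suc n) \<le> 3 ^ n * stripe_coord (Suc n) b"
        "3 ^ n * stripe_coord (Suc n) b \<le> period (Suc n)" using pow[of n] by linarith+
    qed
    ultimately have "\<bar>fst b\<bar> \<le> period (Suc n) \<and> \<bar>snd b\<bar> \<le> period (Suc n)"
      by (auto simp: stripe_coord_def split: if_splits)
    then show ?thesis using quiet[of n] that(1) less_imp_le unfolding quiet_def by blast
  qed
  have conn: "connected_sites (A n)" if "n > N" for n
    unfolding A_def
    by (rule connected_sites_backbones)
      (use good[OF that] connected_sites_block_strip[of "3 ^ n"] in \<open>auto simp: J_def\<close>)
  have in_block: "3 ^ n * stripe_coord m b \<le> stripe_coord m v \<and>
      stripe_coord m v < 3 ^ n * stripe_coord m b + 3 ^ n" if "v \<in> backbone F n b" for v n m b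
  proof -
    have "stripe_coord m v div 3 ^ n = stripe_coord m b"
      using backbone_subset_block[OF that] by (auto simp: stripe_coord_def)
    moreover have "3 ^ n * (stripe_coord m v div 3 ^ n) + stripe_coord m v mod 3 ^ n = stripe_coord m v"
      by (rule mult_div_mod_eq)
    moreover have "0 \<le> stripe_coord m v mod 3 ^ n" "stripe_coord m v mod 3 ^ n < 3 ^ n" by simp_all
    ultimately show ?thesis by (smt (verit))
  qed
  have across: "a n \<le> stripe_coord n v" "stripe_coord n v < a n + stripe_width n"
    and along: "lo (Suc n) \<le> stripe_coord (Suc n) v" "stripe_coord (Suc n) v \<le> hi (Suc n)"
    if v: "v \<in> A n" for n v
  proof -
    obtain b where b: "b \<in> J n" "v \<in> backbone F n b" using v by (auto simp: A_def)
    show "a n \<le> stripe_coord n v" "stripe_coord n v < a n + stripe_width n"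
      using b(1) in_block[OF b(2), of n] i[of n] by (auto simp: J_def)
    show "lo (Suc n) \<le> stripe_coord (Suc n) v" "stripe_coord (Suc n) v \<le> hi (Suc n)"
      using b(1) in_block[OF b(2), of "Suc n"] by (auto simp: J_def)
  qed
  have colour: "noisy_state u F v = c" if n: "n > N" and v: "v \<in> A n" for n v
  proof -
    have bounds: "\<bar>stripe_coord m v\<bar> \<le> period (Suc n)" for m
    proof -
      have "\<bar>stripe_coord n v\<bar> \<le> period n" using across[OF v] corr[OF n] by auto
      then have "\<bar>stripe_coord n v\<bar> \<le> period (Suc n)" using period_mono[of n "Suc n"] by simp
      moreover have "\<bar>stripe_coord (Suc n) v\<bar> \<le> period (Suc n)"
        using along[OF v] corr[of "Suc n"] n by auto
      ultimately show ?thesis by (auto simp: stripe_coord_def split: if_splits)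
    qed
    have high: "\<not> stripe u m c' v" if m: "n + 2 \<le> m" for m c'
    proof -
      obtain k where k: "m = Suc k" "Suc n \<le> k" using m by (cases m) auto
      have "\<bar>stripe_coord m v\<bar> \<le> period k" using bounds[of m] period_mono[OF k(2)] by simp
      then show ?thesis using clear[of k] k n by (simp add: clear_def stripe_def)
    qed
    have "stripe_state u v = c"
    proof (rule stripe_state_eqI[of u n])
      show "stripe u n c v" using across[OF v] corr[OF n] by (auto simp: stripe_def)
      show "\<not> stripe u m (\<not> c) v" if "n \<le> m" for m
      proof -
        consider "m = n" | "m = Suc n" | "n + 2 \<le> m" using \<open>n \<le> m\<close> by linarith
        then show ?thesis
        proof cases
          case 1
          then show ?thesis using across[OF v] corr[OF n] by (auto simp: stripe_def)
        next
          case 2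
          then show ?thesis using along[OF v] corr[of "Suc n"] n by (auto simp: stripe_def)
        qed (rule high)
      qed
    qed (rule high)
    moreover have "v \<notin> F" using v backbone_disjoint good[OF n] by (fastforce simp: A_def)
    ultimately show ?thesis by (simp add: noisy_state_def)
  qed
  have meet: "A n \<inter> A (Suc n) \<noteq> {}" if n: "n > N" for n
  proof -
    \<comment> \<open>A block in row \<open>i n\<close> of level \<open>n\<close> whose parent lies in row \<open>i (Suc n)\<close> of level \<open>n + 1\<close>,
      which is perpendicular to the former.\<close>
    define b where "b = (if even n then (3 * i (Suc n), i n) else (i n, 3 * i (Suc n)))"
    have b: "stripe_coord n b = i n" "stripe_coord (Suc n) b = 3 * i (Suc n)"
      by (auto simp: b_def stripe_coord_def)
    have "3 ^ n * (3 * i (Suc n)) = 3 ^ Suc n * i (Suc n)" "(3::int) ^ n \<le> 3 ^ Suc n" by simp_all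
    then have "lo (Suc n) \<le> 3 ^ n * (3 * i (Suc n))" "3 ^ n * (3 * i (Suc n)) \<le> hi (Suc n) + 1 - 3 ^ n"
      using i_bounds[of "Suc n"] n by linarith+
    then have J1: "b \<in> J n" using b by (simp add: J_def)
    have split: "3 * (i n div 3) \<le> i n" "i n \<le> 3 * (i n div 3) + 2" by linarith+
    define e X where "e = (3::int) ^ n" and "X = e * (3 * (i n div 3))"
    have "X \<le> e * i n" "e * i n \<le> e * (3 * (i n div 3) + 2)"
      unfolding X_def using split by (auto simp: e_def intro!: mult_left_mono)
    moreover have "e * (3 * (i n div 3) + 2) = X + 2 * e" by (simp add: X_def algebra_simps)
    moreover have "- period n \<le> lo n" "hi n \<le> period n" using corr[OF n] by auto
    moreover have "lo (Suc (Suc n)) \<le> - period (Suc n)" "period (Suc n) \<le> hi (Suc (Suc n))"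
      using corr[of "Suc (Suc n)"] n by auto
    ultimately have "lo (Suc (Suc n)) \<le> X" "X \<le> hi (Suc (Suc n)) + 1 - 3 * e"
      using i_bounds[OF n] period_Suc[of n] pow[of n] unfolding power_Suc e_def[symmetric] by linarith+
    moreover have "3 ^ Suc n * (i n div 3) = X" "3 ^ Suc n = 3 * e" by (simp_all add: X_def e_def)
    ultimately have J2: "parent b \<in> J (Suc n)" using b unfolding J_def by (simp only: stripe_coord_parent mem_Collect_eq stripe_coord_add2) simp
    have "backbone F n b \<subseteq> A n" using J1 by (auto simp: A_def)
    moreover have "backbone F n b \<subseteq> backbone F (Suc n) (parent b)" using good[OF n J1] by auto
    then have "backbone F n b \<subseteq> A (Suc n)" using J2 unfolding A_def by blast
    ultimately show ?thesis using backbone_connected_nonempty[OF good[OF n J1]] by blast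
  qed
  define S where "S = (\<Union>k. A (Suc N + k))"
  have "connected_sites S" unfolding S_def
    by (rule connected_sites_chain) (use conn meet in auto)
  moreover have "infinite S"
  proof
    assume "finite S"
    then have "finite ((\<lambda>v. \<bar>fst v\<bar> + \<bar>snd v\<bar>) ` S)" by simp
    then obtain B where "\<forall>t\<in>(\<lambda>v. \<bar>fst v\<bar> + \<bar>snd v\<bar>) ` S. t \<le> B"
      by (rule bdd_above_finite[unfolded bdd_above_def, THEN exE])
    then have B: "\<bar>fst v\<bar> + \<bar>snd v\<bar> \<le> B" if "v \<in> S" for v using that by simp
    define n where "n = Suc (N + nat B)"
    have n: "n > N" by (simp add: n_def)
    obtain v where v: "v \<in> A n" using meet[OF n] by blast
    have "n = Suc N + nat B" by (simp add: n_def)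
    then have "v \<in> S" using v unfolding S_def by blast
    then have "\<bar>stripe_coord n v\<bar> \<le> B" using B[of v] by (auto simp: stripe_coord_def)
    also have "B < half_period (N + nat B)" using half_period_ge[of "N + nat B"] by linarith
    finally have "\<bar>stripe_coord n v\<bar> \<le> period (N + nat B)" by linarith
    then have "\<not> in_stripe n (u n) c (stripe_coord n v)"
      using clear[of "N + nat B"] by (simp add: clear_def n_def)
    then show False using across[OF v] corr[OF n] by auto
  qed
  moreover have "\<forall>v\<in>S. noisy_state u F v = c" unfolding S_def using colour[of "Suc N + _"] by auto
  moreover obtain x where "x \<in> S" using \<open>infinite S\<close> infinite_imp_nonempty by blast
  ultimately show ?thesis using infinite_cluster_at_connected_sites[of S] by blast
qed

section \<open>Events that depend on disjoint sets of coordinates\<close>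

text \<open>An event that depends only on the coordinates in \<open>A\<close> can be read off the restriction to \<open>A\<close>: fill
  the other coordinates with those of a fixed point. So the independence of restrictions to
  disjoint sets of coordinates applies.\<close>

lemma prob_conj_disjoint_coordinates:
  fixes M :: "'i \<Rightarrow> 'a measure"
  assumes prob: "\<And>i. prob_space (M i)"
    and P [measurable]: "Measurable.pred (PiM UNIV M) P"
    and Q [measurable]: "Measurable.pred (PiM UNIV M) Q"
    and dep_P: "\<And>\<omega> \<omega>'. (\<And>i. i \<in> A \<Longrightarrow> \<omega> i = \<omega>' i) \<Longrightarrow> P \<omega> = P \<omega>'"
    and dep_Q: "\<And>\<omega> \<omega>'. (\<And>i. i \<in> B \<Longrightarrow> \<omega> i = \<omega>' i) \<Longrightarrow> Q \<omega> = Q \<omega>'"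
    and disj: "A \<inter> B = {}"
  shows "measure (PiM UNIV M) {\<omega> \<in> space (PiM UNIV M). P \<omega> \<and> Q \<omega>} =
    measure (PiM UNIV M) {\<omega> \<in> space (PiM UNIV M). P \<omega>} *
    measure (PiM UNIV M) {\<omega> \<in> space (PiM UNIV M). Q \<omega>}"
proof -
  let ?W = "PiM UNIV M"
  interpret W: prob_space ?W by (rule prob_space_PiM) (rule prob)
  obtain z where z: "z \<in> space ?W" using W.not_empty by blast
  define ext where "ext C \<xi> = (\<lambda>i. if i \<in> C then \<xi> i else z i)" for C and \<xi> :: "'i \<Rightarrow> 'a"
  have ext [measurable]: "ext C \<in> PiM C M \<rightarrow>\<^sub>M ?W" for C
  proof (rule measurable_PiM_single')
    show "(\<lambda>\<xi>. ext C \<xi> i) \<in> PiM C M \<rightarrow>\<^sub>M M i" for i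
      using z by (cases "i \<in> C") (auto simp: ext_def space_PiM PiE_iff)
    show "ext C \<in> space (PiM C M) \<rightarrow> (\<Pi>\<^sub>E i\<in>UNIV. space (M i))"
      using z by (auto simp: ext_def space_PiM PiE_iff)
  qed
  have "W.indep_vars M (\<lambda>i \<omega>. \<omega> i) UNIV"
    by (subst W.indep_vars_iff_distr_eq_PiM)
      (auto simp: distr_PiM_component prob restrict_def cong: PiM_cong)
  then have "W.indep_var (PiM A M) (\<lambda>\<omega>. restrict (\<lambda>i. \<omega> i) A) (PiM B M) (\<lambda>\<omega>. restrict (\<lambda>i. \<omega> i) B)"
    by (rule W.indep_var_restrict) (use disj in auto)
  note indep = W.indep_varD[OF this]
  define XA where "XA = {\<xi> \<in> space (PiM A M). P (ext A \<xi>)}"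
  define XB where "XB = {\<xi> \<in> space (PiM B M). Q (ext B \<xi>)}"
  have [measurable]: "XA \<in> sets (PiM A M)" "XB \<in> sets (PiM B M)"
    unfolding XA_def XB_def by measurable
  have A: "(\<lambda>\<omega>. restrict (\<lambda>i. \<omega> i) A) -` XA \<inter> space ?W = {\<omega> \<in> space ?W. P \<omega>}"
  proof -
    have "P (ext A (restrict \<omega> A)) = P \<omega>" for \<omega> by (rule dep_P) (simp add: ext_def)
    then show ?thesis by (auto simp: XA_def space_PiM)
  qed
  have B: "(\<lambda>\<omega>. restrict (\<lambda>i. \<omega> i) B) -` XB \<inter> space ?W = {\<omega> \<in> space ?W. Q \<omega>}"
  proof -
    have "Q (ext B (restrict \<omega> B)) = Q \<omega>" for \<omega> by (rule dep_Q) (simp add: ext_def)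
    then show ?thesis by (auto simp: XB_def space_PiM)
  qed
  have "(\<lambda>\<omega>. (restrict (\<lambda>i. \<omega> i) A, restrict (\<lambda>i. \<omega> i) B)) -` (XA \<times> XB) \<inter> space ?W =
    {\<omega> \<in> space ?W. P \<omega> \<and> Q \<omega>}" using A B by blast
  then show ?thesis using indep[of XA XB] A B by simp
qed

section \<open>The source of randomness\<close>

text \<open>All coordinates are independent and uniform: the offset of the stripes of each level, over one
  period, and for each site a variable that flips its state when it vanishes. The value 162 is twice 81, the
  number of pairs of children of a block, and makes the recursion for bad blocks start at
  \<open>(1 / 81) * (1 / 2)\<close>.\<close>

definition num_values :: "nat + vertex \<Rightarrow> int" where
  "num_values = case_sum period (\<lambda>_. 162)"

definition randomness :: "(nat + vertex \<Rightarrow> int) measure" where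
  "randomness = PiM UNIV (\<lambda>i. measure_pmf (pmf_of_set {0..<num_values i}))"

definition offset :: "(nat + vertex \<Rightarrow> int) \<Rightarrow> nat \<Rightarrow> int" where
  "offset \<omega> n = \<omega> (Inl n)"

definition flipped :: "(nat + vertex \<Rightarrow> int) \<Rightarrow> vertex set" where
  "flipped \<omega> = {v. \<omega> (Inr v) = 0}"

definition sample :: "(nat + vertex \<Rightarrow> int) \<Rightarrow> config" where
  "sample \<omega> = noisy_state (offset \<omega>) (flipped \<omega>)"

lemma num_values_pos: "0 < num_values i"
  using half_period_pos by (cases i) (auto simp: num_values_def)

lemma space_randomness [simp]: "space randomness = UNIV"
  by (simp add: randomness_def space_PiM)

lemma sets_randomness [measurable_cong]:
  "sets randomness = sets (PiM UNIV (\<lambda>_. count_space UNIV))"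
  unfolding randomness_def by (rule sets_PiM_cong) auto

interpretation randomness: prob_space randomness
  unfolding randomness_def by (rule prob_space_PiM) (rule prob_space_measure_pmf)

interpretation coordinates: product_prob_space "\<lambda>i. measure_pmf (pmf_of_set {0..<num_values i})" UNIV
  by unfold_locales

lemma measurable_coordinate [measurable]:
  "(\<lambda>\<omega>. \<omega> i) \<in> randomness \<rightarrow>\<^sub>M count_space UNIV"
  unfolding measurable_cong_sets[OF sets_randomness refl] by simp

lemma pred_coordinate: "Measurable.pred randomness (\<lambda>\<omega>. R (\<omega> i))"
  by (rule measurable_compose[OF measurable_coordinate]) simp

lemma prob_conj_disjoint:
  assumes "Measurable.pred randomness P" "Measurable.pred randomness Q"
    and "\<And>\<omega> \<omega>'. (\<And>i. i \<in> A \<Longrightarrow> \<omega> i = \<omega>' i) \<Longrightarrow> P \<omega> = P \<omega>'"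
    and "\<And>\<omega> \<omega>'. (\<And>i. i \<in> B \<Longrightarrow> \<omega> i = \<omega>' i) \<Longrightarrow> Q \<omega> = Q \<omega>'"
    and "A \<inter> B = {}"
  shows "measure randomness {\<omega>. P \<omega> \<and> Q \<omega>} =
    measure randomness {\<omega>. P \<omega>} * measure randomness {\<omega>. Q \<omega>}"
proof -
  have "measure randomness {\<omega> \<in> space randomness. P \<omega> \<and> Q \<omega>} =
    measure randomness {\<omega> \<in> space randomness. P \<omega>} * measure randomness {\<omega> \<in> space randomness. Q \<omega>}"
    by (rule prob_conj_disjoint_coordinates[where A=A and B=B and
        M="\<lambda>i. measure_pmf (pmf_of_set {0..<num_values i})", folded randomness_def])
      (fact prob_space_measure_pmf assms)+
  then show ?thesis by simp
qed

lemma prob_coordinate: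
  "measure randomness {\<omega>. \<omega> i \<in> A} = card ({0..<num_values i} \<inter> A) / num_values i"
proof -
  have "emeasure randomness {\<omega>. \<omega> i \<in> A} = measure_pmf (pmf_of_set {0..<num_values i}) A"
    using coordinates.emeasure_PiM_Collect_single[of i A]
    by (simp add: randomness_def[symmetric] space_randomness)
  then show ?thesis using num_values_pos[of i]
    by (simp add: measure_def measure_pmf_of_set[unfolded measure_def] emeasure_pmf_of_set)
qed

lemma prob_flipped: "measure randomness {\<omega>. x \<in> flipped \<omega>} = 1 / 162"
proof -
  have "measure randomness {\<omega>. \<omega> (Inr x) \<in> {0}} = card ({0..<162} \<inter> {0::int}) / 162"
    using prob_coordinate[of "Inr x" "{0}"] by (simp add: num_values_def)
  also have "{0..<162} \<inter> {0::int} = {0}" by auto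
  finally show ?thesis by (simp add: flipped_def)
qed

lemma map_pmf_rotate:
  fixes p k :: int
  assumes "0 < p"
  shows "map_pmf (\<lambda>s. (s + k) mod p) (pmf_of_set {0..<p}) = pmf_of_set {0..<p}"
proof (rule map_pmf_of_set_bij_betw)
  have inj: "inj_on (\<lambda>s. (s + k) mod p) {0..<p}"
  proof (rule inj_onI)
    fix s t assume st: "s \<in> {0..<p}" "t \<in> {0..<p}" "(s + k) mod p = (t + k) mod p"
    then have "(s + k - k) mod p = (t + k - k) mod p" by (metis mod_diff_left_eq)
    then show "s = t" using st by simp
  qed
  moreover have "(\<lambda>s. (s + k) mod p) ` {0..<p} \<subseteq> {0..<p}" using assms by auto
  ultimately show "bij_betw (\<lambda>s. (s + k) mod p) {0..<p} {0..<p}"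
    unfolding bij_betw_def by (metis endo_inj_surj finite_atLeastLessThan_int)
qed (use assms in auto)

section \<open>Translation invariance\<close>

text \<open>Moving the configuration by \<open>y\<close> amounts to rotating each offset within its period and relabelling the
  site variables. Both operations preserve the product measure, and the offsets of different levels need no
  coordination because the levels are independent.\<close>

definition shift :: "vertex \<Rightarrow> (nat + vertex \<Rightarrow> int) \<Rightarrow> nat + vertex \<Rightarrow> int" where
  "shift y \<omega> = case_sum (\<lambda>n. (\<omega> (Inl n) + stripe_coord n y) mod period n) (\<lambda>v. \<omega> (Inr (v + y)))"

lemma in_stripe_shift: "in_stripe n ((s + k) mod period n) c t \<longleftrightarrow> in_stripe n s c (t + k)"
proof -
  have "(t + (s + k) mod period n - r) mod period n = (t + k + s - r) mod period n" for r
  proof -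
    have "(t + (s + k) mod period n - r) mod period n = ((t - r) + (s + k) mod period n) mod period n"
      by (simp add: algebra_simps)
    also have "\<dots> = ((t - r) + (s + k)) mod period n" by (rule mod_add_right_eq)
    finally show ?thesis by (simp add: algebra_simps)
  qed
  then show ?thesis by (simp add: in_stripe_def)
qed

lemma sample_shift: "sample (shift y \<omega>) v = sample \<omega> (v + y)"
proof -
  have "stripe (offset (shift y \<omega>)) n c v = stripe (offset \<omega>) n c (v + y)" for n c
    by (auto simp: stripe_def offset_def shift_def in_stripe_shift stripe_coord_def)
  then show ?thesis
    by (simp add: sample_def noisy_state_def stripe_state_def flipped_def shift_def)
qed

lemma measurable_shift: "shift y \<in> randomness \<rightarrow>\<^sub>M randomness"
  unfolding measurable_cong_sets[OF refl sets_randomness]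
proof (rule measurable_PiM_single')
  show "(\<lambda>\<omega>. shift y \<omega> i) \<in> randomness \<rightarrow>\<^sub>M count_space UNIV" for i
  proof (cases i)
    case (Inl n)
    show ?thesis unfolding Inl shift_def sum.case
      by (rule measurable_compose[OF measurable_coordinate]) simp
  qed (simp add: shift_def)
qed auto

lemma distr_shift: "distr randomness randomness (shift y) = randomness"
  unfolding randomness_def
proof (rule coordinates.PiM_eq, unfold randomness_def[symmetric])
  note measurable_shift [measurable]
  show "sets (distr randomness randomness (shift y)) = sets randomness" by simp
  fix J :: "(nat + vertex) set" and F :: "nat + vertex \<Rightarrow> int set"
  assume J: "finite J"
  let ?M = "\<lambda>i. measure_pmf (pmf_of_set {0..<num_values i})"
  define \<sigma> :: "nat + vertex \<Rightarrow> nat + vertex" where "\<sigma> = map_sum id (\<lambda>v. v + y)"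
  define G where "G = case_sum (\<lambda>n. {s. (s + stripe_coord n y) mod period n \<in> F (Inl n)})
    (\<lambda>v. F (Inr (v - y)))"
  have inj: "inj \<sigma>" by (auto simp: \<sigma>_def intro!: sum.inj_map)
  have emb: "prod_emb UNIV ?M J (Pi\<^sub>E J F) = {\<omega>. \<forall>j\<in>J. \<omega> j \<in> F j}"
    by (auto simp: prod_emb_def space_PiM PiE_iff restrict_def)
  have sets: "{\<omega>. \<forall>j\<in>J. \<omega> j \<in> F j} \<in> sets randomness"
    using sets_PiM_I[of J UNIV F ?M] J unfolding emb by (simp add: randomness_def)
  have mem: "shift y \<omega> j \<in> F j \<longleftrightarrow> \<omega> (\<sigma> j) \<in> G (\<sigma> j)" for \<omega> j
    by (cases j) (auto simp: shift_def \<sigma>_def G_def)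
  have comp: "emeasure (?M (\<sigma> j)) (G (\<sigma> j)) = emeasure (?M j) (F j)" for j
  proof (cases j)
    case (Inl n)
    let ?p = "pmf_of_set {0..<period n}"
    have "emeasure ?p (F j) = emeasure (map_pmf (\<lambda>s. (s + stripe_coord n y) mod period n) ?p) (F j)"
      using map_pmf_rotate[of "period n"] half_period_pos[of n] by simp
    then show ?thesis using Inl by (simp add: \<sigma>_def G_def num_values_def vimage_def)
  qed (simp add: \<sigma>_def G_def num_values_def)
  have "emeasure (distr randomness randomness (shift y)) {\<omega>. \<forall>j\<in>J. \<omega> j \<in> F j} =
    emeasure randomness {\<omega>. \<forall>i\<in>\<sigma> ` J. \<omega> i \<in> G i}"
    using sets by (simp add: emeasure_distr vimage_def mem)
  also have "\<dots> = (\<Prod>i\<in>\<sigma> ` J. emeasure (?M i) (G i))"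
    using coordinates.emeasure_PiM_Collect[of "\<sigma> ` J" G] J
    by (simp add: randomness_def[symmetric])
  also have "\<dots> = (\<Prod>j\<in>J. emeasure (?M j) (F j))"
    using inj by (subst prod.reindex) (auto simp: comp intro: inj_on_subset)
  finally show "emeasure (distr randomness randomness (shift y)) (prod_emb UNIV ?M J (Pi\<^sub>E J F)) =
    (\<Prod>j\<in>J. emeasure (?M j) (F j))" unfolding emb .
qed

lemma pred_stripe [measurable]: "Measurable.pred randomness (\<lambda>\<omega>. stripe (offset \<omega>) n c v)"
  unfolding stripe_def offset_def by (rule pred_coordinate)

lemma pred_stripe_state [measurable]: "Measurable.pred randomness (\<lambda>\<omega>. stripe_state (offset \<omega>) v)"
  unfolding stripe_state_def by measurable

lemma pred_flipped [measurable]: "Measurable.pred randomness (\<lambda>\<omega>. v \<in> flipped \<omega>)"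
  unfolding flipped_def mem_Collect_eq by (rule pred_coordinate)

lemma pred_sample [measurable]: "Measurable.pred randomness (\<lambda>\<omega>. sample \<omega> v)"
  unfolding sample_def noisy_state_def by measurable

lemma measurable_sample [measurable]: "sample \<in> randomness \<rightarrow>\<^sub>M config_space UNIV"
  unfolding config_space_def by (rule measurable_PiM_single') auto

definition percolation_law :: "config measure" where
  "percolation_law = distr randomness (config_space UNIV) sample"

lemma sets_percolation_law [simp, measurable_cong]: "sets percolation_law = sets (config_space UNIV)"
  by (simp add: percolation_law_def)

lemma space_percolation_law [simp]: "space percolation_law = UNIV"
  by (simp add: percolation_law_def config_space_def space_PiM)

lemma site_percolation_law: "site_percolation percolation_law (\<lambda>c. c)"
proof -
  have "prob_space percolation_law"
    unfolding percolation_law_def by (rule randomness.prob_space_distr) measurable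
  then show ?thesis
    unfolding site_percolation_def by (simp add: measurable_ident_sets)
qed

lemma measurable_marginal [measurable]:
  "(\<lambda>c. \<lambda>i\<in>I. c (x i)) \<in> config_space UNIV \<rightarrow>\<^sub>M PiM I (\<lambda>_. count_space UNIV)"
  unfolding config_space_def by measurable

lemma translation_invariant_law: "translation_invariant percolation_law (\<lambda>c. c)"
proof -
  have "distr percolation_law (PiM I (\<lambda>_. count_space UNIV)) (\<lambda>c. \<lambda>i\<in>I. c (x i + y)) =
    distr percolation_law (PiM I (\<lambda>_. count_space UNIV)) (\<lambda>c. \<lambda>i\<in>I. c (x i))"
    (is "distr _ ?P _ = _") for I :: "nat set" and x :: "nat \<Rightarrow> vertex" and y
  proof -
    have "distr percolation_law ?P (\<lambda>c. \<lambda>i\<in>I. c (x i + y)) =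
      distr randomness ?P (\<lambda>\<omega>. \<lambda>i\<in>I. sample \<omega> (x i + y))"
      unfolding percolation_law_def by (subst distr_distr) (auto simp: comp_def)
    also have "\<dots> = distr randomness ?P ((\<lambda>\<omega>. \<lambda>i\<in>I. sample \<omega> (x i)) \<circ> shift y)"
      by (simp add: comp_def sample_shift)
    also have "\<dots> = distr (distr randomness randomness (shift y)) ?P (\<lambda>\<omega>. \<lambda>i\<in>I. sample \<omega> (x i))"
      by (rule distr_distr[symmetric]) (auto simp: measurable_shift)
    also have "\<dots> = distr percolation_law ?P (\<lambda>c. \<lambda>i\<in>I. c (x i))"
      unfolding distr_shift percolation_law_def by (subst distr_distr) (auto simp: comp_def)
    finally show ?thesis .
  qed
  then show ?thesis unfolding translation_invariant_def by metis
qed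

section \<open>Almost surely only finitely many scales fail\<close>

lemma bad_cong_block:
  assumes "\<And>v. fst v div 3 ^ k = fst b \<Longrightarrow> snd v div 3 ^ k = snd b \<Longrightarrow> v \<in> F \<longleftrightarrow> v \<in> F'"
  shows "bad F k b = bad F' k b"
  using assms
proof (induction k arbitrary: b)
  case (Suc k)
  have "bad F k b' = bad F' k b'" if "parent b' = b" for b'
  proof (rule Suc.IH)
    fix v assume "fst v div 3 ^ k = fst b'" "snd v div 3 ^ k = snd b'"
    then have "fst v div 3 ^ Suc k = fst b" "snd v div 3 ^ Suc k = snd b"
      unfolding power_Suc2 using that by (auto simp: zdiv_zmult2_eq parent_def)
    then show "v \<in> F \<longleftrightarrow> v \<in> F'" by (rule Suc.prems)
  qed
  then show ?case unfolding bad.simps by metis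
qed auto

lemma pred_bad [measurable]: "Measurable.pred randomness (\<lambda>\<omega>. bad (flipped \<omega>) k b)"
  by (induction k arbitrary: b) simp_all

text \<open>The probability \<open>p k\<close> of a bad block satisfies \<open>p (Suc k) \<le> 81 * (p k)\<^sup>2\<close>: there are at most 81 pairs
  of distinct children, and distinct children depend on disjoint sets of sites.\<close>

lemma prob_bad_le: "measure randomness {\<omega>. bad (flipped \<omega>) k b} \<le> (1 / 81) * (1 / 2) ^ 2 ^ k"
proof (induction k arbitrary: b)
  case 0
  show ?case using prob_flipped[of b] by simp
next
  case (Suc k)
  let ?p = "(1 / 81) * (1 / 2) ^ 2 ^ k :: real"
  define C where "C = {3 * fst b..3 * fst b + 2} \<times> {3 * snd b..3 * snd b + 2}"
  have C: "parent b' = b \<longleftrightarrow> b' \<in> C" for b' by (cases b; cases b') (auto simp: C_def parent_def)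
  define I where "I = {d \<in> C \<times> C. fst d \<noteq> snd d}"
  have "card C = 9" by (simp add: C_def card_cartesian_product)
  then have "card (C \<times> C) = 81" by (simp add: card_cartesian_product)
  moreover have fin: "finite (C \<times> C)" by (simp add: C_def)
  ultimately have I: "finite I" "card I \<le> 81"
    unfolding I_def using card_mono[OF fin, of "{d \<in> C \<times> C. fst d \<noteq> snd d}"] by auto
  let ?E = "\<lambda>d. {\<omega>. bad (flipped \<omega>) k (fst d) \<and> bad (flipped \<omega>) k (snd d)}"
  have E: "?E d \<in> sets randomness" for d
  proof -
    have "{\<omega> \<in> space randomness. bad (flipped \<omega>) k (fst d) \<and> bad (flipped \<omega>) k (snd d)} \<in> sets randomness"
      by measurable
    then show ?thesis by simp
  qed
  have "measure randomness (?E d) \<le> ?p\<^sup>2" if "d \<in> I" for d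
  proof -
    let ?B = "\<lambda>c. {Inr v |v. fst v div 3 ^ k = fst c \<and> snd v div 3 ^ k = snd c} :: (nat + vertex) set"
    have "measure randomness (?E d) =
      measure randomness {\<omega>. bad (flipped \<omega>) k (fst d)} * measure randomness {\<omega>. bad (flipped \<omega>) k (snd d)}"
    proof (rule prob_conj_disjoint[OF pred_bad pred_bad, where A="?B (fst d)" and B="?B (snd d)"])
      show "?B (fst d) \<inter> ?B (snd d) = {}" using that by (auto simp: I_def prod_eq_iff)
    qed (auto intro!: bad_cong_block simp: flipped_def)
    also have "\<dots> \<le> ?p * ?p" by (intro mult_mono Suc.IH) auto
    finally show ?thesis by (simp add: power2_eq_square)
  qed
  then have "(\<Sum>d\<in>I. measure randomness (?E d)) \<le> card I * ?p\<^sup>2" by (rule sum_bounded_above)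
  also have "\<dots> \<le> 81 * ?p\<^sup>2" using I by (intro mult_right_mono) auto
  also have "\<dots> = (1 / 81) * (1 / 2) ^ 2 ^ Suc k"
    by (simp add: power2_eq_square power_mult_distrib power_add[symmetric] mult_2)
  finally have sum: "(\<Sum>d\<in>I. measure randomness (?E d)) \<le> (1 / 81) * (1 / 2) ^ 2 ^ Suc k" .
  have "{\<omega>. bad (flipped \<omega>) (Suc k) b} \<subseteq> (\<Union>d\<in>I. ?E d)"
  proof
    fix \<omega> assume "\<omega> \<in> {\<omega>. bad (flipped \<omega>) (Suc k) b}"
    then obtain b1 b2 where "b1 \<in> C" "b2 \<in> C" "b1 \<noteq> b2" "bad (flipped \<omega>) k b1" "bad (flipped \<omega>) k b2"
      using C by auto
    then show "\<omega> \<in> (\<Union>d\<in>I. ?E d)" by (intro UN_I[of "(b1, b2)"]) (auto simp: I_def)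
  qed
  then have "measure randomness {\<omega>. bad (flipped \<omega>) (Suc k) b} \<le> measure randomness (\<Union>d\<in>I. ?E d)"
    using I E by (intro randomness.finite_measure_mono) auto
  also have "\<dots> \<le> (\<Sum>d\<in>I. measure randomness (?E d))"
    using I E by (intro randomness.finite_measure_subadditive_finite) auto
  finally show ?case using sum by linarith
qed

lemma pred_clear [measurable]: "Measurable.pred randomness (\<lambda>\<omega>. clear (offset \<omega>) n)"
proof -
  have [measurable]: "Measurable.pred randomness (\<lambda>\<omega>. in_stripe m (offset \<omega> m) c t)" for m c t
    unfolding offset_def by (rule pred_coordinate)
  show ?thesis unfolding clear_def by measurable
qed

lemma pred_quiet [measurable]: "Measurable.pred randomness (\<lambda>\<omega>. quiet (flipped \<omega>) n)"
  unfolding quiet_def by measurable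

lemma prob_not_quiet_le:
  "measure randomness {\<omega>. \<not> quiet (flipped \<omega>) n} \<le>
    (2 * period (Suc n) + 1)\<^sup>2 * ((1 / 81) * (1 / 2) ^ 2 ^ n)"
proof -
  let ?p = "period (Suc n)"
  define J where "J = {b :: vertex. \<bar>fst b\<bar> \<le> ?p \<and> \<bar>snd b\<bar> \<le> ?p}"
  have J: "J = {- ?p..?p} \<times> {- ?p..?p}" by (auto simp: J_def abs_le_iff)
  have E: "{\<omega>. bad (flipped \<omega>) n b} \<in> sets randomness" for b
    using pred_bad[of n b] by (simp add: pred_def)
  have "{\<omega>. \<not> quiet (flipped \<omega>) n} = (\<Union>b\<in>J. {\<omega>. bad (flipped \<omega>) n b})"
    unfolding quiet_def J_def by blast
  then have "measure randomness {\<omega>. \<not> quiet (flipped \<omega>) n} \<le>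
    (\<Sum>b\<in>J. measure randomness {\<omega>. bad (flipped \<omega>) n b})"
    using E by (auto intro!: randomness.finite_measure_subadditive_finite simp: J)
  also have "\<dots> \<le> card J * ((1 / 81) * (1 / 2) ^ 2 ^ n)"
    using prob_bad_le by (intro sum_bounded_above) auto
  also have "real (card J) = (2 * ?p + 1)\<^sup>2"
    using half_period_pos[of "Suc n"]
    by (simp add: J card_cartesian_product power2_eq_square)
  finally show ?thesis by simp
qed

text \<open>A uniform offset makes the position of any coordinate uniform within the period.\<close>

lemma prob_in_stripe:
  "measure randomness {\<omega>. in_stripe n (offset \<omega> n) c t} \<le> stripe_width n / period n"
proof -
  let ?p = "period n" and ?k = "t - (if c then 0 else half_period n)"
  let ?D = "measure_pmf (pmf_of_set {0..<?p})"
  have "measure randomness {\<omega>. in_stripe n (offset \<omega> n) c t} =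
    measure randomness {\<omega>. \<omega> (Inl n) \<in> {s. (s + ?k) mod ?p < stripe_width n}}"
    by (simp add: in_stripe_def offset_def algebra_simps)
  also have "\<dots> = measure ?D {s. (s + ?k) mod ?p < stripe_width n}"
    using half_period_pos[of n] prob_coordinate[of "Inl n" "{s. (s + ?k) mod ?p < stripe_width n}"]
    by (simp add: num_values_def measure_pmf_of_set)
  also have "\<dots> = measure (measure_pmf (map_pmf (\<lambda>s. (s + ?k) mod ?p) (pmf_of_set {0..<?p}))) {..<stripe_width n}"
    by (simp add: vimage_def)
  also have "\<dots> = measure ?D {..<stripe_width n}"
    using map_pmf_rotate[of ?p ?k] half_period_pos[of n] by simp
  also have "\<dots> = card ({0..<?p} \<inter> {..<stripe_width n}) / ?p"
    using half_period_pos[of n] by (simp add: measure_pmf_of_set)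
  also have "\<dots> \<le> stripe_width n / ?p"
  proof -
    have "card ({0..<?p} \<inter> {..<stripe_width n}) \<le> card {0..<stripe_width n}"
      by (intro card_mono) auto
    also have "int (card {0..<stripe_width n}) = stripe_width n" by (simp add: stripe_width_def)
    finally have "real (card ({0..<?p} \<inter> {..<stripe_width n})) \<le> real_of_int (stripe_width n)"
      by linarith
    then show ?thesis using half_period_pos[of n] by (intro divide_right_mono) auto
  qed
  finally show ?thesis .
qed

lemma prob_not_clear_le:
  "measure randomness {\<omega>. \<not> clear (offset \<omega>) n} \<le>
    2 * (2 * period n + 1) * (stripe_width (Suc n) / period (Suc n))"
proof -
  define J where "J = {d :: bool \<times> int. \<bar>snd d\<bar> \<le> period n}"
  have J: "J = UNIV \<times> {- period n..period n}" by (auto simp: J_def abs_le_iff)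
  let ?E = "\<lambda>d. {\<omega>. in_stripe (Suc n) (offset \<omega> (Suc n)) (fst d) (snd d)}"
  have E: "?E d \<in> sets randomness" for d
    using pred_coordinate[of "\<lambda>s. in_stripe (Suc n) s (fst d) (snd d)" "Inl (Suc n)"]
    by (simp add: pred_def offset_def)
  have "{\<omega>. \<not> clear (offset \<omega>) n} = (\<Union>d\<in>J. ?E d)"
    unfolding clear_def J_def by force
  then have "measure randomness {\<omega>. \<not> clear (offset \<omega>) n} \<le> (\<Sum>d\<in>J. measure randomness (?E d))"
    using E by (auto intro!: randomness.finite_measure_subadditive_finite simp: J)
  also have "\<dots> \<le> card J * (stripe_width (Suc n) / period (Suc n))"
    using prob_in_stripe by (intro sum_bounded_above) auto
  also have "real (card J) = 2 * (2 * period n + 1)"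
    using half_period_pos[of n] by (simp add: J card_cartesian_product card_UNIV_bool)
  finally show ?thesis by simp
qed

text \<open>The bound is of order \<open>3 ^ n * period n / period (Suc n)\<close>, and the ratio of the periods
  is \<open>1 / 4 ^ (2 * n + 3)\<close>.\<close>

lemma summable_prob_not_clear: "summable (\<lambda>n. measure randomness {\<omega>. \<not> clear (offset \<omega>) n})"
proof (rule summable_comparison_test)
  show "summable (\<lambda>n. 30 * (3 / 16 :: real) ^ n)" by (intro summable_mult summable_geometric) auto
  have "measure randomness {\<omega>. \<not> clear (offset \<omega>) n} \<le> 30 * (3 / 16) ^ n" for n
  proof -
    define h where "h = real_of_int (half_period n)"
    have h: "1 \<le> h" using half_period_pos[of n] by (simp add: h_def)
    have "((n + 2)\<^sup>2) = (n + 1)\<^sup>2 + (2 * n + 3)" by (simp add: power2_eq_square)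
    then have half_Suc: "real_of_int (half_period (Suc n)) = h * 4 ^ (2 * n + 3)"
      by (simp add: half_period_def h_def power_add)
    have pow: "(4::real) ^ (2 * n + 3) = 64 * 16 ^ n" by (simp add: power_add power_mult)
    have "2 * (2 * (2 * h) + 1) * (2 * 3 ^ Suc n / (2 * (h * 4 ^ (2 * n + 3)))) \<le>
      2 * (5 * h) * (2 * 3 ^ Suc n / (2 * (h * 4 ^ (2 * n + 3))))"
      using h by (intro mult_right_mono) auto
    also have "\<dots> = (30 / 64) * (3 / 16) ^ n"
      using h unfolding pow by (simp add: field_simps)
    also have "\<dots> \<le> 30 * (3 / 16) ^ n" by (intro mult_right_mono) auto
    finally show ?thesis
      using prob_not_clear_le[of n] half_Suc by (simp add: stripe_width_def h_def[symmetric])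
  qed
  then show "\<exists>N. \<forall>n\<ge>N. norm (measure randomness {\<omega>. \<not> clear (offset \<omega>) n}) \<le> 30 * (3 / 16 :: real) ^ n"
    by simp
qed

text \<open>There are about \<open>2 ^ (4 * (n + 2)\<^sup>2)\<close> blocks to check, each bad with probability
  at most \<open>(1 / 2) ^ 2 ^ n\<close>; from level 10 on the second exponent exceeds the first by at least \<open>n\<close>.\<close>

lemma summable_prob_not_quiet: "summable (\<lambda>n. measure randomness {\<omega>. \<not> quiet (flipped \<omega>) n})"
proof (rule summable_comparison_test)
  show "summable (\<lambda>n. (1 / 2 :: real) ^ n)" by (intro summable_geometric) auto
  have "measure randomness {\<omega>. \<not> quiet (flipped \<omega>) n} \<le> (1 / 2) ^ n" if n: "10 \<le> n" for n
  proof -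
    define h where "h = real_of_int (half_period (Suc n))"
    have h: "1 \<le> h" using half_period_pos[of "Suc n"] by (simp add: h_def)
    have exponent: "4 * (n + 2)\<^sup>2 + n \<le> 2 ^ n" using n
    proof (induction n rule: dec_induct)
      case (step m)
      have "4 * (Suc m + 2)\<^sup>2 + Suc m \<le> 2 * (4 * (m + 2)\<^sup>2 + m)"
        using step(1) by (simp add: power2_eq_square algebra_simps)
      then show ?case using step.IH by simp
    qed simp
    have "h\<^sup>2 = 4 ^ (2 * (n + 2)\<^sup>2)" by (simp add: h_def half_period_def power_mult[symmetric] mult.commute)
    also have "\<dots> = 2 ^ (4 * (n + 2)\<^sup>2)"
      using power_mult[of "2::real" 2 "2 * (n + 2)\<^sup>2"] by simp
    finally have h2: "h\<^sup>2 = 2 ^ (4 * (n + 2)\<^sup>2)" .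
    have "(2 * (2 * h) + 1)\<^sup>2 * ((1 / 81) * (1 / 2) ^ 2 ^ n) \<le> (9 * h)\<^sup>2 * ((1 / 81) * (1 / 2) ^ 2 ^ n)"
      using h by (intro mult_right_mono power_mono) auto
    also have "\<dots> = 2 ^ (4 * (n + 2)\<^sup>2) * (1 / 2) ^ 2 ^ n" by (simp add: power_mult_distrib h2)
    also have "\<dots> \<le> 2 ^ (4 * (n + 2)\<^sup>2) * (1 / 2) ^ (4 * (n + 2)\<^sup>2 + n)"
      using exponent by (intro mult_left_mono power_decreasing) auto
    also have "\<dots> = (1 / 2) ^ n" by (simp add: power_add power_one_over)
    finally show ?thesis using prob_not_quiet_le[of n] by (simp add: h_def)
  qed
  then show "\<exists>N. \<forall>n\<ge>N. norm (measure randomness {\<omega>. \<not> quiet (flipped \<omega>) n}) \<le> (1 / 2 :: real) ^ n"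
    by auto
qed

lemma AE_eventually_if_summable:
  assumes [measurable]: "\<And>n. Measurable.pred randomness (P n)"
    and "summable (\<lambda>n. measure randomness {\<omega>. \<not> P n \<omega>})"
  shows "AE \<omega> in randomness. eventually (\<lambda>n. P n \<omega>) sequentially"
proof -
  have "{\<omega> \<in> space randomness. \<not> P n \<omega>} \<in> sets randomness" for n by measurable
  then have "AE \<omega> in randomness. eventually (\<lambda>n. \<omega> \<in> space randomness - {\<omega>. \<not> P n \<omega>}) sequentially"
    using assms(2) randomness.emeasure_finite
    by (intro borel_cantelli_AE1) (auto simp: less_top[symmetric])
  then show ?thesis by simp
qed

lemma AE_sample_infinite_clusters:
  "AE \<omega> in randomness. \<forall>c. \<exists>x. sample \<omega> x = c \<and> infinite_cluster_at (sample \<omega>) x"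
proof -
  have "AE \<omega> in randomness. eventually (\<lambda>n. clear (offset \<omega>) n) sequentially"
    by (rule AE_eventually_if_summable[OF pred_clear summable_prob_not_clear])
  moreover have "AE \<omega> in randomness. eventually (\<lambda>n. quiet (flipped \<omega>) n) sequentially"
    by (rule AE_eventually_if_summable[OF pred_quiet summable_prob_not_quiet])
  ultimately show ?thesis
  proof eventually_elim
    case (elim \<omega>)
    then have "eventually (\<lambda>n. clear (offset \<omega>) n \<and> quiet (flipped \<omega>) n) sequentially"
      by (rule eventually_conj)
    then obtain N where N: "\<And>n. N \<le> n \<Longrightarrow> clear (offset \<omega>) n \<and> quiet (flipped \<omega>) n"
      by (auto simp: eventually_sequentially)
    show ?case unfolding sample_def
      by (intro allI infinite_cluster_of_stripes[of N]) (use N in auto)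
  qed
qed

lemma pred_state [measurable]: "Measurable.pred (config_space UNIV) (\<lambda>c. c v)"
  unfolding config_space_def by measurable

text \<open>Measurability: a set of sites is infinite iff no list covers it, and there are countably
  many lists.\<close>

lemma pred_infinite_cluster_at [measurable]:
  "Measurable.pred (config_space UNIV) (\<lambda>c. infinite_cluster_at c x)"
proof -
  have [measurable]: "Measurable.pred (config_space UNIV) (\<lambda>c. communicate c x y)" for y
    unfolding communicate_def by measurable
  have "infinite_cluster_at c x \<longleftrightarrow> (\<forall>ys. \<exists>y. communicate c x y \<and> y \<notin> set ys)" for c
  proof -
    have "finite {y. communicate c x y} \<longleftrightarrow> (\<exists>ys. {y. communicate c x y} \<subseteq> set ys)"
      by (metis finite_list finite_set finite_subset order_refl)
    then show ?thesis unfolding infinite_cluster_at_def by blast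
  qed
  then show ?thesis by simp
qed

lemma AE_law_infinite_clusters:
  "AE c in percolation_law. (\<exists>C. open_cluster c C \<and> infinite C) \<and> (\<exists>C. closed_cluster c C \<and> infinite C)"
proof -
  have "AE c in percolation_law. \<forall>b. \<exists>x. c x = b \<and> infinite_cluster_at c x"
    unfolding percolation_law_def
    by (subst AE_distr_iff) (use AE_sample_infinite_clusters in measurable)
  then show ?thesis
  proof eventually_elim
    case (elim c)
    obtain x y where "c x" "infinite_cluster_at c x" "\<not> c y" "infinite_cluster_at c y"
      using elim[rule_format, of True] elim[rule_format, of False] by auto
    then show ?case using ex_infinite_open_cluster ex_infinite_closed_cluster by blast
  qed
qed

section \<open>Uniform finite energy\<close>

lemma measurable_off [measurable]:
  "(\<lambda>c. restrict c V) \<in> config_space UNIV \<rightarrow>\<^sub>M config_space V"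
  unfolding config_space_def by (rule measurable_restrict_subset) simp

lemma prob_disjoint_disj:
  assumes [measurable]: "Measurable.pred randomness R" "Measurable.pred randomness S"
    and disj: "\<And>\<omega>. \<not> (R \<omega> \<and> S \<omega>)"
  shows "measure randomness {\<omega>. R \<omega> \<or> S \<omega>} = measure randomness {\<omega>. R \<omega>} + measure randomness {\<omega>. S \<omega>}"
proof -
  have "{\<omega> \<in> space randomness. R \<omega>} \<in> sets randomness" "{\<omega> \<in> space randomness. S \<omega>} \<in> sets randomness"
    by measurable
  then have "measure randomness ({\<omega>. R \<omega>} \<union> {\<omega>. S \<omega>}) = measure randomness {\<omega>. R \<omega>} + measure randomness {\<omega>. S \<omega>}"
    using disj by (intro randomness.finite_measure_Union) auto
  then show ?thesis by (simp add: Collect_disj_eq)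
qed

lemma prob_flipped_conj:
  assumes [measurable]: "Measurable.pred randomness Q"
    and dep: "\<And>\<omega> \<omega>'. (\<And>i. i \<noteq> Inr x \<Longrightarrow> \<omega> i = \<omega>' i) \<Longrightarrow> Q \<omega> = Q \<omega>'"
  shows "measure randomness {\<omega>. x \<in> flipped \<omega> \<and> Q \<omega>} = (1 / 162) * measure randomness {\<omega>. Q \<omega>}"
    and "measure randomness {\<omega>. x \<notin> flipped \<omega> \<and> Q \<omega>} = (161 / 162) * measure randomness {\<omega>. Q \<omega>}"
proof -
  have "measure randomness {\<omega>. x \<in> flipped \<omega> \<and> Q \<omega>} =
    measure randomness {\<omega>. x \<in> flipped \<omega>} * measure randomness {\<omega>. Q \<omega>}"
  proof (rule prob_conj_disjoint[OF pred_flipped assms(1), where A="{Inr x}" and B="- {Inr x}"])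
    show "Q \<omega> = Q \<omega>'" if "\<And>i. i \<in> - {Inr x} \<Longrightarrow> \<omega> i = \<omega>' i" for \<omega> \<omega>'
      using that by (intro dep) auto
  qed (auto simp: flipped_def)
  then show flip: "measure randomness {\<omega>. x \<in> flipped \<omega> \<and> Q \<omega>} =
    (1 / 162) * measure randomness {\<omega>. Q \<omega>}" by (simp add: prob_flipped)
  have "measure randomness {\<omega>. Q \<omega>} =
    measure randomness {\<omega>. (x \<in> flipped \<omega> \<and> Q \<omega>) \<or> (x \<notin> flipped \<omega> \<and> Q \<omega>)}"
    by (rule arg_cong[where f="measure randomness"]) blast
  also have "\<dots> =
    measure randomness {\<omega>. x \<in> flipped \<omega> \<and> Q \<omega>} + measure randomness {\<omega>. x \<notin> flipped \<omega> \<and> Q \<omega>}"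
    by (rule prob_disjoint_disj) 
      (rule pred_intros_logic(3)[OF pred_flipped assms(1)],
        rule pred_intros_logic(3)[OF pred_intros_logic(2)[OF pred_flipped] assms(1)], blast)
  finally have "measure randomness {\<omega>. Q \<omega>} = \<dots>" .
  then show "measure randomness {\<omega>. x \<notin> flipped \<omega> \<and> Q \<omega>} = (161 / 162) * measure randomness {\<omega>. Q \<omega>}"
    using flip by linarith
qed

definition off :: "vertex \<Rightarrow> config \<Rightarrow> config" where
  "off x c = restrict c (- {x})"

lemma measurable_off_site [measurable]: "off x \<in> config_space UNIV \<rightarrow>\<^sub>M config_space (- {x})"
  unfolding off_def by measurable

text \<open>The stripes and the configuration off \<open>x\<close> do not involve the flip variable of \<open>x\<close>. So conditionally on
  them \<open>x\<close> is open with probability \<open>161 / 162\<close> or \<open>1 / 162\<close>, according to whether the stripes make it open.\<close>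

lemma prob_open_and_off:
  assumes B [measurable]: "B \<in> sets (config_space (- {x}))"
  shows "measure randomness {\<omega>. sample \<omega> x \<and> off x (sample \<omega>) \<in> B} =
    (1 / 162) * measure randomness {\<omega>. off x (sample \<omega>) \<in> B} +
    (160 / 162) * measure randomness {\<omega>. stripe_state (offset \<omega>) x \<and> off x (sample \<omega>) \<in> B}"
proof -
  let ?Q = "\<lambda>b \<omega>. stripe_state (offset \<omega>) x = b \<and> off x (sample \<omega>) \<in> B"
  have Q [measurable]: "Measurable.pred randomness (?Q b)" for b by measurable
  have dep: "?Q b \<omega> = ?Q b \<omega>'" if "\<And>i. i \<noteq> Inr x \<Longrightarrow> \<omega> i = \<omega>' i" for b \<omega> \<omega>'
  proof -
    have "offset \<omega> = offset \<omega>'" using that by (auto simp: offset_def)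
    moreover from this have "off x (sample \<omega>) = off x (sample \<omega>')"
      using that by (auto simp: off_def sample_def noisy_state_def flipped_def restrict_def)
    ultimately show ?thesis by simp
  qed
  have flip: "measure randomness {\<omega>. x \<in> flipped \<omega> \<and> ?Q b \<omega>} = (1 / 162) * measure randomness {\<omega>. ?Q b \<omega>}"
    and no_flip: "measure randomness {\<omega>. x \<notin> flipped \<omega> \<and> ?Q b \<omega>} = (161 / 162) * measure randomness {\<omega>. ?Q b \<omega>}"
    for b
    by (intro prob_flipped_conj[OF Q] dep; blast)+
  have "measure randomness {\<omega>. sample \<omega> x \<and> off x (sample \<omega>) \<in> B} =
    measure randomness {\<omega>. (x \<in> flipped \<omega> \<and> ?Q False \<omega>) \<or> (x \<notin> flipped \<omega> \<and> ?Q True \<omega>)}"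
    by (rule arg_cong[where f="measure randomness"]) (auto simp: sample_def noisy_state_def)
  also have "\<dots> =
      measure randomness {\<omega>. x \<in> flipped \<omega> \<and> ?Q False \<omega>} +
      measure randomness {\<omega>. x \<notin> flipped \<omega> \<and> ?Q True \<omega>}"
    by (rule prob_disjoint_disj) 
      (rule pred_intros_logic(3)[OF pred_flipped Q],
        rule pred_intros_logic(3)[OF pred_intros_logic(2)[OF pred_flipped] Q], blast)
  also have "\<dots> = (1 / 162) * measure randomness {\<omega>. ?Q False \<omega>} +
      (161 / 162) * measure randomness {\<omega>. ?Q True \<omega>}"
    by (rule arg_cong2[where f="(+)", OF flip no_flip])
  finally have "measure randomness {\<omega>. sample \<omega> x \<and> off x (sample \<omega>) \<in> B} = \<dots>" .
  moreover have "measure randomness {\<omega>. off x (sample \<omega>) \<in> B} =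
    measure randomness {\<omega>. ?Q False \<omega>} + measure randomness {\<omega>. ?Q True \<omega>}"
  proof -
    have "measure randomness {\<omega>. off x (sample \<omega>) \<in> B} =
      measure randomness {\<omega>. ?Q False \<omega> \<or> ?Q True \<omega>}"
      by (rule arg_cong[where f="measure randomness"]) auto
    also have "\<dots> = measure randomness {\<omega>. ?Q False \<omega>} + measure randomness {\<omega>. ?Q True \<omega>}"
      by (rule prob_disjoint_disj) (rule Q, rule Q, blast)
    finally show ?thesis .
  qed
  ultimately show ?thesis by (simp add: algebra_simps)
qed

text \<open>The densities of \<open>\<nu>\<close> and \<open>\<nu>'\<close> add up to 1 almost everywhere, so each of them has a version with
  values between 0 and 1 everywhere.\<close>

lemma ex_bounded_density:
  fixes \<mu> \<nu> \<nu>' :: "'a measure"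
  assumes "finite_measure \<mu>" and sets: "sets \<nu> = sets \<mu>" "sets \<nu>' = sets \<mu>"
    and sum: "\<And>B. B \<in> sets \<mu> \<Longrightarrow> emeasure \<mu> B = emeasure \<nu> B + emeasure \<nu>' B"
  shows "\<exists>g\<in>borel_measurable \<mu>. (\<forall>z. 0 \<le> g z \<and> g z \<le> (1::real)) \<and> density \<mu> (\<lambda>z. ennreal (g z)) = \<nu>"
proof -
  interpret finite_measure \<mu> by fact
  have "absolutely_continuous \<mu> \<nu>" "absolutely_continuous \<mu> \<nu>'"
    unfolding absolutely_continuous_def using sum sets by (auto simp: null_sets_def)
  then obtain f f' where f [measurable]: "f \<in> borel_measurable \<mu>" "f' \<in> borel_measurable \<mu>"
    and dens: "density \<mu> f = \<nu>" "density \<mu> f' = \<nu>'"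
    using Radon_Nikodym[of \<nu>] Radon_Nikodym[of \<nu>'] sets by blast
  have "density \<mu> (\<lambda>z. f z + f' z) = density \<mu> (\<lambda>_. 1)"
  proof (rule measure_eqI)
    fix B assume "B \<in> sets (density \<mu> (\<lambda>z. f z + f' z))"
    then have B [measurable]: "B \<in> sets \<mu>" by simp
    have "emeasure (density \<mu> (\<lambda>z. f z + f' z)) B = emeasure (density \<mu> f) B + emeasure (density \<mu> f') B"
      by (simp add: emeasure_density distrib_right nn_integral_add)
    then show "emeasure (density \<mu> (\<lambda>z. f z + f' z)) B = emeasure (density \<mu> (\<lambda>_. 1)) B"
      using sum[OF B] dens by (simp add: emeasure_density)
  qed simp
  then have "AE z in \<mu>. f z + f' z = 1" by (subst (asm) density_unique_iff) auto
  then have "AE z in \<mu>. f z = ennreal (min 1 (enn2real (f z)))"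
  proof eventually_elim
    case (elim z)
    have "f z \<le> f z + f' z" by simp
    then have "f z \<le> 1" using elim by simp
    then show ?case by (cases "f z") (auto simp: min_def top_unique)
  qed
  then have "density \<mu> (\<lambda>z. ennreal (min 1 (enn2real (f z)))) = density \<mu> f"
    by (intro density_cong) auto
  then show ?thesis using dens by (intro bexI[of _ "\<lambda>z. min 1 (enn2real (f z))"]) auto
qed

text \<open>Let \<open>g\<close> be the conditional probability, given the configuration off \<open>x\<close>, that the stripes make \<open>x\<close>
  open. By \<open>prob_open_and_off\<close> the conditional probability that \<open>x\<close> is open is
  \<open>1 / 162 + 160 / 162 * g\<close>, and a version of \<open>g\<close> with values between 0 and 1 gives the bounds
  everywhere. The function \<open>g\<close> is obtained as a density on the space of configurations off \<open>x\<close>, so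
  that it is directly a function of them.\<close>

lemma cond_prob_law:
  "\<exists>p. cond_prob_open percolation_law (\<lambda>c. c) x p \<and> (\<forall>\<xi>. 1 / 162 \<le> p \<xi> \<and> p \<xi> \<le> 161 / 162)"
proof -
  let ?N = "config_space (- {x})"
  define \<mu> where "\<mu> = distr randomness ?N (\<lambda>\<omega>. off x (sample \<omega>))"
  define \<nu> where "\<nu> b = distr (density randomness (indicator {\<omega>. stripe_state (offset \<omega>) x = b})) ?N
    (\<lambda>\<omega>. off x (sample \<omega>))" for b
  have ev: "{\<omega>. stripe_state (offset \<omega>) x = b} \<in> sets randomness" for b
  proof -
    have "{\<omega> \<in> space randomness. stripe_state (offset \<omega>) x = b} \<in> sets randomness" by measurable
    then show ?thesis by simp
  qed
  have offev: "{\<omega>. off x (sample \<omega>) \<in> B} \<in> sets randomness" if [measurable]: "B \<in> sets ?N" for B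
  proof -
    have "{\<omega> \<in> space randomness. off x (sample \<omega>) \<in> B} \<in> sets randomness" by measurable
    then show ?thesis by simp
  qed
  have \<mu>: "emeasure \<mu> B = emeasure randomness {\<omega>. off x (sample \<omega>) \<in> B}" if "B \<in> sets ?N" for B
    using that unfolding \<mu>_def by (subst emeasure_distr) (auto simp: vimage_def)
  have \<nu>: "emeasure (\<nu> b) B = emeasure randomness {\<omega>. stripe_state (offset \<omega>) x = b \<and> off x (sample \<omega>) \<in> B}"
    if "B \<in> sets ?N" for b B
  proof -
    have "emeasure (\<nu> b) B =
      emeasure (density randomness (indicator {\<omega>. stripe_state (offset \<omega>) x = b})) {\<omega>. off x (sample \<omega>) \<in> B}"
      using that unfolding \<nu>_def by (subst emeasure_distr) (auto simp: vimage_def)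
    also have "\<dots> = emeasure randomness ({\<omega>. stripe_state (offset \<omega>) x = b} \<inter> {\<omega>. off x (sample \<omega>) \<in> B})"
      using ev[of b] offev[OF that]
      by (subst emeasure_density) (auto simp: indicator_inter_arith[symmetric])
    finally show ?thesis by (simp add: Collect_conj_eq)
  qed
  have "\<exists>g\<in>borel_measurable \<mu>. (\<forall>z. 0 \<le> g z \<and> g z \<le> (1::real)) \<and> density \<mu> (\<lambda>z. ennreal (g z)) = \<nu> True"
  proof (rule ex_bounded_density[where \<nu>'="\<nu> False"])
    show "finite_measure \<mu>"
      unfolding \<mu>_def by (intro prob_space.finite_measure randomness.prob_space_distr) measurable
    fix B assume "B \<in> sets \<mu>"
    then have B: "B \<in> sets ?N" by (simp add: \<mu>_def)
    let ?S = "\<lambda>b. {\<omega>. stripe_state (offset \<omega>) x = b \<and> off x (sample \<omega>) \<in> B}"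
    have "?S b \<in> sets randomness" for b
      using sets.Int[OF ev[of b] offev[OF B]] by (simp add: Collect_conj_eq)
    then have "emeasure randomness (?S True) + emeasure randomness (?S False) =
      emeasure randomness (?S True \<union> ?S False)" by (intro plus_emeasure) blast+
    also have "?S True \<union> ?S False = {\<omega>. off x (sample \<omega>) \<in> B}" by auto
    finally show "emeasure \<mu> B = emeasure (\<nu> True) B + emeasure (\<nu> False) B"
      unfolding \<mu>[OF B] \<nu>[OF B] ..
  qed (simp_all add: \<mu>_def \<nu>_def)
  then obtain g where g [measurable]: "g \<in> borel_measurable ?N" and g01: "\<And>z. 0 \<le> g z" "\<And>z. g z \<le> 1"
    and dens: "density \<mu> (\<lambda>z. ennreal (g z)) = \<nu> True"
    by (auto simp: \<mu>_def)
  define p where "p \<xi> = 1 / 162 + (160 / 162) * g \<xi>" for \<xi>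
  have p [measurable]: "p \<in> borel_measurable ?N" unfolding p_def by measurable
  have p_bounds: "1 / 162 \<le> p \<xi>" "p \<xi> \<le> 161 / 162" for \<xi>
    using g01[of \<xi>] by (auto simp: p_def)
  interpret \<mu>: prob_space \<mu>
    unfolding \<mu>_def by (rule randomness.prob_space_distr) measurable
  interpret law: prob_space percolation_law
    using site_percolation_law by (simp add: site_percolation_def)
  have \<mu>_law: "\<mu> = distr percolation_law ?N (off x)"
    unfolding \<mu>_def percolation_law_def by (subst distr_distr) (auto simp: comp_def)
  define F where "F = vimage_algebra (space percolation_law) (off x) ?N"
  have sets_F: "sets F = {off x -` B |B. B \<in> sets ?N}"
  proof -
    have "off x \<in> space percolation_law \<rightarrow> space ?N"
      by (auto simp: off_def config_space_def space_PiM)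
    then show ?thesis unfolding F_def by (subst sets_vimage_algebra2) auto
  qed
  have "off x -` B \<in> sets percolation_law" if "B \<in> sets ?N" for B
    using measurable_sets[OF measurable_off_site that] by (simp add: config_space_def space_PiM)
  then have "subalgebra percolation_law F"
    unfolding subalgebra_def by (auto simp: sets_F) (simp_all add: F_def)
  then interpret sub: finite_measure_subalgebra percolation_law F
    by unfold_locales
  have open_set [measurable]: "{c. c x} \<in> sets percolation_law"
  proof -
    have "{c \<in> space (config_space UNIV). c x} \<in> sets (config_space UNIV)" by measurable
    then show ?thesis by (simp add: config_space_def space_PiM)
  qed
  have "AE c in percolation_law. real_cond_exp percolation_law F (indicator {c. c x}) c = p (off x c)"
  proof (rule sub.real_cond_exp_charact)
    show "integrable percolation_law (indicator {c. c x} :: config \<Rightarrow> real)"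
      using open_set by (simp add: law.emeasure_finite less_top[symmetric])
    show "integrable percolation_law (\<lambda>c. p (off x c))"
    proof (rule law.integrable_const_bound)
      have "norm (p (off x c)) \<le> 161 / 162" for c
        using p_bounds[of "off x c"] by simp
      then show "AE c in percolation_law. norm (p (off x c)) \<le> 161 / 162" by simp
    qed measurable
    show "(\<lambda>c. p (off x c)) \<in> borel_measurable F"
      unfolding F_def
      by (rule measurable_compose[OF measurable_vimage_algebra1 p])
        (auto simp: off_def config_space_def space_PiM)
    fix A assume "A \<in> sets F"
    then obtain B where B [measurable]: "B \<in> sets ?N" and A: "A = off x -` B" by (auto simp: sets_F)
    have gint: "(\<integral>z. indicator B z * g z \<partial>\<mu>) = measure (\<nu> True) B"
    proof -
      have "measure (\<nu> True) B = enn2real (\<integral>\<^sup>+ z. ennreal (indicator B z * g z) \<partial>\<mu>)"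
        unfolding measure_def dens[symmetric] using g01
        by (subst emeasure_density)
          (auto simp: \<mu>_def ennreal_mult ennreal_indicator mult.commute intro!: arg_cong[where f=enn2real] nn_integral_cong)
      also have "\<dots> = (\<integral>z. indicator B z * g z \<partial>\<mu>)"
        using g01 by (subst integral_eq_nn_integral) (auto simp: \<mu>_def)
      finally show ?thesis ..
    qed
    have "(\<integral>c\<in>A. indicator {c. c x} c \<partial>percolation_law) = measure percolation_law ({c. c x} \<inter> A)"
      unfolding set_lebesgue_integral_def
      by (simp add: indicator_inter_arith[symmetric] Int_commute)
    also have "\<dots> = measure randomness {\<omega>. sample \<omega> x \<and> off x (sample \<omega>) \<in> B}"
    proof -
      have "{c \<in> space (config_space UNIV). c x \<and> off x c \<in> B} \<in> sets (config_space UNIV)" by measurable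
      then show ?thesis unfolding percolation_law_def A
        using measurable_sample
        by (subst measure_distr) (auto simp: vimage_def config_space_def space_PiM Collect_conj_eq)
    qed
    also have "\<dots> = (1 / 162) * measure \<mu> B + (160 / 162) * measure (\<nu> True) B"
      using prob_open_and_off[OF B] by (simp add: measure_def \<mu>[OF B] \<nu>[OF B])
    also have "\<dots> = (\<integral>z. indicator B z * p z \<partial>\<mu>)"
    proof -
      have "integrable \<mu> (\<lambda>z. indicator B z * g z)"
        by (rule \<mu>.integrable_const_bound[of _ 1])
          (use g01 in \<open>auto simp: \<mu>_def indicator_def\<close>)
      moreover have "integrable \<mu> (indicator B :: config \<Rightarrow> real)"
        using \<mu>.emeasure_finite by (simp add: \<mu>_def less_top[symmetric])
      moreover have "indicator B z * p z = (1 / 162) * indicator B z + (160 / 162) * (indicator B z * g z)" for z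
        by (simp add: p_def algebra_simps)
      ultimately show ?thesis using gint by (simp add: \<mu>_def)
    qed
    also have "\<dots> = (\<integral>c. indicator B (off x c) * p (off x c) \<partial>percolation_law)"
      unfolding \<mu>_law by (subst integral_distr) auto
    also have "\<dots> = (\<integral>c\<in>A. p (off x c) \<partial>percolation_law)"
      unfolding set_lebesgue_integral_def A by (simp add: indicator_def)
    finally show "(\<integral>c\<in>A. indicator {c. c x} c \<partial>percolation_law) = (\<integral>c\<in>A. p (off x c) \<partial>percolation_law)" .
  qed
  then have "cond_prob_open percolation_law (\<lambda>c. c) x p"
    unfolding cond_prob_open_def F_def by (simp add: off_def[abs_def])
  then show ?thesis using p_bounds by blast
qed

lemma uniform_finite_energy_law: "uniform_finite_energy percolation_law (\<lambda>c. c)"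
proof -
  obtain p where p: "\<And>x. cond_prob_open percolation_law (\<lambda>c. c) x (p x)"
    "\<And>x \<xi>. 1 / 162 \<le> p x \<xi>" "\<And>x \<xi>. p x \<xi> \<le> 161 / 162"
    using cond_prob_law by metis
  \<comment> \<open>The inequalities to prove are strict, so the constant is taken below \<open>1 / 162\<close>.\<close>
  have "1 / 200 < p x \<xi> \<and> p x \<xi> < 1 - 1 / 200" for x \<xi>
    using p(2)[of x \<xi>] p(3)[of x \<xi>] by auto
  then show ?thesis unfolding uniform_finite_energy_def
    using p(1) by (intro exI[of _ "1 / 200 :: real"]) auto
qed

theorem theorem1p2:
  "\<exists>(M :: config measure) (X :: config \<Rightarrow> config).
     site_percolation M X \<and>
     translation_invariant M X \<and>
     uniform_finite_energy M X \<and>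
     (AE \<omega> in M. (\<exists>C. open_cluster (X \<omega>) C \<and> infinite C) \<and>
                 (\<exists>C. closed_cluster (X \<omega>) C \<and> infinite C))"
  using site_percolation_law translation_invariant_law uniform_finite_energy_law
    AE_law_infinite_clusters by blast

end
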